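(* Let $\mathfrak{g}_h$ be an $n$-dimensional Lie algebra over $\mathbb{K}$ ($\mathbb{K}=\mathbb{R}$ or $\mathbb{C}$) with basis $X_1,\dots,X_n$ and $[X_\mu,X_\nu]=\sum_{\alpha=1}^n C_{\mu\nu\alpha}X_\alpha$, where the structure constants $C_{\mu\nu\alpha}=C_{\mu\nu\alpha}(h)$ depend on a parameter $h\in\mathbb{R}$ with $\lim_{h\to0}C_{\mu\nu\alpha}(h)=0$. Let $\mathcal{H}$ be the unital associative algebra with generators $X_\mu,T_{\mu\nu},T^{-1}_{\mu\nu}$ associated to $\mathfrak{g}_h$ and let $\hat{\mathcal{A}}_n$ be the semicompleted Weyl algebra (both described in the context). Let $\mathbf{C}$ be the $n\times n$ matrix with entries $\mathbf{C}_{\mu\nu}=\sum_{\alpha=1}^n C_{\mu\alpha\nu}\partial_\alpha$ and let $\psi(t)=\frac{t}{1-e^{-t}}$. Then $\mathcal{H}$ admits the following realization in $\hat{\mathcal{A}}_n$: the assignment $X_\mu\mapsto\hat x_\mu$, $T_{\mu\nu}\mapsto\widehat T_{\mu\nu}$, $T^{-1}_{\mu\nu}\mapsto\widehat T^{-1}_{\mu\nu}$, with $$\hat x_\mu=\sum_{\alpha=1}^n x_\alpha\,\psi_{\mu\alpha}(\mathbf{C}),\qquad \widehat T_{\mu\nu}=(e^{\mathbf{C}})_{\mu\nu},\qquad \widehat T^{-1}_{\mu\nu}=(e^{-\mathbf{C}})_{\mu\nu},$$ where $\psi_{\mu\nu}(\mathbf{C})$ denotes the $(\mu,\nu)$ entry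 of the matrix $\psi(\mathbf{C})$, extends to a homomorphism of unital associative algebras $\mathcal{H}\to\hat{\mathcal{A}}_n$ (that is, these elements satisfy all defining relations of $\mathcal{H}$).
   Context: The algebra $\mathcal{H}$: the unital associative $\mathbb{K}$-algebra with generators $X_\mu,T_{\mu\nu},T^{-1}_{\mu\nu}$, $1\le\mu,\nu\le n$, subject to the relations (with $[\cdot,\cdot]$ the commutator) $$[X_\mu,X_\nu]=\sum_{\alpha}C_{\mu\nu\alpha}X_\alpha,\quad [T_{\mu\nu},T_{\alpha\beta}]=0,\quad [T_{\mu\nu},X_\lambda]=\sum_{\alpha}C_{\mu\lambda\alpha}T_{\alpha\nu},$$ $$[T^{-1}_{\alpha\beta},T^{-1}_{\mu\nu}]=0,\quad [T^{-1}_{\mu\nu},X_\lambda]=\sum_{\alpha}C_{\lambda\alpha\nu}T^{-1}_{\mu\alpha},\quad \sum_{\alpha}T^{-1}_{\mu\alpha}T_{\alpha\nu}=\sum_{\alpha}T_{\mu\alpha}T^{-1}_{\alpha\nu}=\delta_{\mu\nu}.$$ The Weyl algebra $\mathcal{A}_n$ is the unital associative $\mathbb{K}$-algebra generated by $x_1,\dots,x_n,\partial_1,\dots,\partial_n$ with $[x_\mu,x_\nu]=[\partial_\mu,\partial_\nu]=0$, $[\partial_\mu,x_\nu]=\delta_{\mu\nu}$. $\hat{\mathcal{A}}_n$ is its semicompletion by the order of differential operators: it contains formal power series in the $\partial_\mu$ but only polynomial expressions in the $x_\mu$ (coefficients of monomials in $\partial$, written to the right, are polynomials in $x$). For a formal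 power series $F(t)=\sum_k f_k t^k$, $F(\mathbf{C})=\sum_k f_k\mathbf{C}^k$, a matrix with entries formal power series in $\partial_1,\dots,\partial_n$; $e^{\mathbf{C}}=\sum_{k\ge0}\mathbf{C}^k/k!$. Explicitly $\psi(t)=\frac{t}{1-e^{-t}}=\sum_{k\ge0}\frac{(-1)^k}{k!}B_kt^k$, with $B_k$ the Bernoulli numbers, $B_1=-\tfrac12$. *)

theory Defs
  imports
    "HOL-Analysis.Analysis"
    "HOL-Library.Poly_Mapping"
    "HOL-Computational_Algebra.Formal_Power_Series"
    "HOL-Algebra.QuotRing"
    "HOL-Algebra.Module"
begin

section \<open>Lie algebras with an indexed basis\<close>

locale lie_algebra = vector_space scale
  for scale :: "'k::field \<Rightarrow> 'g::ab_group_add \<Rightarrow> 'g" +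
  fixes bracket :: "'g \<Rightarrow> 'g \<Rightarrow> 'g"
  assumes bracket_add_left: "bracket (x + y) z = bracket x z + bracket y z"
    and bracket_add_right: "bracket x (y + z) = bracket x y + bracket x z"
    and bracket_scale_left: "bracket (scale c x) y = scale c (bracket x y)"
    and bracket_scale_right: "bracket x (scale c y) = scale c (bracket x y)"
    and bracket_self: "bracket x x = 0"
    and jacobi: "bracket x (bracket y z) + bracket y (bracket z x) + bracket z (bracket x y) = 0"

definition (in vector_space) indexed_basis :: "('i \<Rightarrow> 'b) \<Rightarrow> bool" where
  "indexed_basis X \<longleftrightarrow> inj X \<and> independent (range X) \<and> span (range X) = UNIV"


section \<open>Multi-indices and multivariate polynomials\<close>

text \<open>Polynomials in the commuting variables \<open>x\<^sub>i\<close>, \<open>i :: 'n\<close>, are finitely supported maps from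
  multi-indices to coefficients, with the convolution product of \<^theory>\<open>HOL-Library.Poly_Mapping\<close>.\<close>

type_synonym 'n mindex = "'n \<Rightarrow>\<^sub>0 nat"
type_synonym ('n, 'k) mpolynomial = "('n \<Rightarrow>\<^sub>0 nat) \<Rightarrow>\<^sub>0 'k"

definition mbinom :: "'n::finite mindex \<Rightarrow> 'n mindex \<Rightarrow> nat" where
  "mbinom a b = (\<Prod>i\<in>UNIV. Poly_Mapping.lookup a i choose Poly_Mapping.lookup b i)"

definition mfact :: "'n::finite mindex \<Rightarrow> 'k::field_char_0" where
  "mfact a = (\<Prod>i\<in>UNIV. fact (Poly_Mapping.lookup a i))"

definition splits :: "'n mindex \<Rightarrow> ('n mindex \<times> 'n mindex) set" where
  "splits d = {(a, b). a + b = d}"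

text \<open>The iterated partial derivative: \<open>x\<^sup>b\<close> is sent to \<open>(b! / (b - k)!) x\<^sup>(\<^sup>b\<^sup>-\<^sup>k\<^sup>)\<close> if \<open>k \<le> b\<close>
  componentwise, and to \<open>0\<close> otherwise.\<close>

lift_definition mderiv :: "'n::finite mindex \<Rightarrow> ('n, 'k::field_char_0) mpolynomial \<Rightarrow> ('n, 'k) mpolynomial"
  is "\<lambda>k q a. mfact (a + k) / mfact a * q (a + k)"
proof -
  fix k :: "'n mindex" and q :: "'n mindex \<Rightarrow> 'k"
  assume fin: "finite {b. q b \<noteq> 0}"
  have "finite ((\<lambda>a. a + k) -` {b. q b \<noteq> 0})"
    by (rule finite_vimageI[OF fin]) (simp add: inj_on_def)
  then show "finite {a. mfact (a + k) / mfact a * q (a + k) \<noteq> 0}"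
    by (rule rev_finite_subset) auto
qed

lemma finite_mindex_box: "finite {b :: 'n::finite mindex. \<forall>i. Poly_Mapping.lookup b i \<le> N i}"
proof -
  have "finite (PiE UNIV (\<lambda>i. {..N i}))" by (intro finite_PiE) auto
  then have "finite (Poly_Mapping.lookup -` (PiE UNIV (\<lambda>i. {..N i})))"
    by (rule finite_vimageI) (metis injI poly_mapping_eqI)
  then show ?thesis by (rule rev_finite_subset) auto
qed

lemma finite_mindex_below: "finite {b :: 'n::finite mindex. \<exists>a. a + b = d}"
  by (rule finite_subset[OF _ finite_mindex_box[of "Poly_Mapping.lookup d"]])
     (auto simp: lookup_add)

lemma finite_splits [simp]: "finite (splits (d :: 'n::finite mindex))"
proof -
  have "finite ((\<lambda>b. (d - b, b)) ` {b. \<exists>a. a + b = d})"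
    using finite_mindex_below by blast
  then show ?thesis by (rule rev_finite_subset) (auto simp: splits_def image_iff)
qed

lemma mfact_nonzero [simp]: "mfact a \<noteq> 0"
  by (simp add: mfact_def)

lemma mfact_0 [simp]: "mfact 0 = 1"
  by (simp add: mfact_def)

lemma mbinom_mfact: "of_nat (mbinom (a + b) b) = (mfact (a + b) / (mfact a * mfact b) :: 'k::field_char_0)"
  by (simp add: mbinom_def mfact_def lookup_add binomial_fact prod_dividef prod.distrib mult.commute)

lemma mbinom_eq_0: assumes "\<nexists>c. c + b = a" shows "mbinom a b = 0"
proof -
  have "\<exists>i. Poly_Mapping.lookup a i < Poly_Mapping.lookup b i"
  proof (rule ccontr)
    assume "\<not> ?thesis"
    then have "(a - b) + b = a"
      by (intro poly_mapping_eqI) (simp add: lookup_add lookup_minus not_less)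
    with assms show False by blast
  qed
  then show ?thesis by (auto simp: mbinom_def)
qed

lemma mbinom_vandermonde:
  "mbinom (a + b) d = (\<Sum>(k, e)\<in>splits d. mbinom a k * mbinom b e)"
proof -
  let ?l = Poly_Mapping.lookup
  have "mbinom (a + b) d = (\<Prod>i\<in>UNIV. \<Sum>k\<in>{..?l d i}. (?l a i choose k) * (?l b i choose (?l d i - k)))"
    by (simp add: mbinom_def lookup_add vandermonde)
  also have "\<dots> = (\<Sum>g\<in>PiE UNIV (\<lambda>i. {..?l d i}).
      \<Prod>i\<in>UNIV. (?l a i choose g i) * (?l b i choose (?l d i - g i)))"
    by (subst prod_sum_PiE) auto
  also have "\<dots> = (\<Sum>(k, e)\<in>splits d. mbinom a k * mbinom b e)"
  proof (rule sum.reindex_bij_witness[where i = "\<lambda>(k, e). ?l k"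
        and j = "\<lambda>g. (Abs_poly_mapping g, d - Abs_poly_mapping g)"], goal_cases)
    case (1 g) then show ?case by simp
  next
    case (2 g) then show ?case
      by (auto simp: splits_def PiE_iff intro!: poly_mapping_eqI simp: lookup_add lookup_minus)
  next
    case (3 p) then show ?case by (auto simp: splits_def)
  next
    case (4 p) then show ?case by (auto simp: splits_def lookup_add)
  next
    case (5 g) then show ?case by (simp add: mbinom_def prod.distrib lookup_minus)
  qed
  finally show ?thesis .
qed

lemma mderiv_0 [simp]: "mderiv k 0 = 0"
  by transfer simp

lemma mderiv_add: "mderiv k (p + q) = mderiv k p + mderiv k q"
  by transfer (simp add: fun_eq_iff algebra_simps)

lemma mderiv_sum: "mderiv k (sum f S) = (\<Sum>s\<in>S. mderiv k (f s))"
  by (induction S rule: infinite_finite_induct) (auto simp: mderiv_add)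

lemma mderiv_zero_index [simp]: "mderiv 0 q = q"
  by transfer simp

lemma lookup_mderiv:
  "Poly_Mapping.lookup (mderiv k q) a = mfact (a + k) / mfact a * Poly_Mapping.lookup q (a + k)"
  by transfer simp

lemma mderiv_mderiv: "mderiv k (mderiv l q) = mderiv (k + l) q"
  by (intro poly_mapping_eqI) (simp add: lookup_mderiv add.assoc)

lemma mderiv_single:
  "mderiv k (Poly_Mapping.single b c) =
    Poly_Mapping.single (b - k) (mfact k * of_nat (mbinom b k) * c)"
proof (cases "\<exists>d. d + k = b")
  case True
  then obtain d where b: "b = d + k" by blast
  then show ?thesis
    by (intro poly_mapping_eqI) (simp add: lookup_mderiv lookup_single when_def mbinom_mfact)
next
  case False
  then have "mbinom b k = 0" by (rule mbinom_eq_0)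
  moreover have "mderiv k (Poly_Mapping.single b c) = 0"
    using False by (intro poly_mapping_eqI) (auto simp: lookup_mderiv lookup_single when_def)
  ultimately show ?thesis by simp
qed

lemma finite_mderiv: "finite {k. mderiv k q \<noteq> 0}"
proof -
  have "{k. mderiv k q \<noteq> 0} \<subseteq> (\<Union>d\<in>Poly_Mapping.keys q. {b. \<exists>a. a + b = d})"
  proof
    fix k assume "k \<in> {k. mderiv k q \<noteq> 0}"
    then obtain a where "Poly_Mapping.lookup (mderiv k q) a \<noteq> 0"
      by (metis (mono_tags) lookup_zero mem_Collect_eq poly_mapping_eqI)
    then have "a + k \<in> Poly_Mapping.keys q" by (auto simp: lookup_mderiv in_keys_iff)
    then show "k \<in> (\<Union>d\<in>Poly_Mapping.keys q. {b. \<exists>a. a + b = d})" by blast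
  qed
  then show ?thesis by (rule finite_subset) (auto intro: finite_mindex_below)
qed

lemma mpolynomial_sum_single: "p = (\<Sum>a\<in>Poly_Mapping.keys p. Poly_Mapping.single a (Poly_Mapping.lookup p a))"
  by (intro poly_mapping_eqI) (auto simp: lookup_sum lookup_single when_def in_keys_iff)

lemma single_sum: "Poly_Mapping.single a (sum f S) = (\<Sum>s\<in>S. Poly_Mapping.single a (f s))"
  by (induction S rule: infinite_finite_induct) (auto simp: single_add)

lemma of_nat_mult_single:
  "of_nat N * Poly_Mapping.single a c * Poly_Mapping.single b e = Poly_Mapping.single (a + b) (of_nat N * c * e)"
  by (metis add_0 mult_single single_of_nat)

lemma mderiv_mult_single:
  "mderiv d (Poly_Mapping.single a c * Poly_Mapping.single b e) =
    (\<Sum>(k, l)\<in>splits d. of_nat (mbinom d k) * mderiv k (Poly_Mapping.single a c) * mderiv l (Poly_Mapping.single b e))"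
proof -
  have *: "of_nat (mbinom d k) * mderiv k (Poly_Mapping.single a c) * mderiv l (Poly_Mapping.single b e)
     = Poly_Mapping.single (a + b - d) (mfact d * of_nat (mbinom a k * mbinom b l) * (c * e))"
    if "(k, l) \<in> splits d" for k l
  proof (cases "(\<exists>u. u + k = a) \<and> (\<exists>v. v + l = b)")
    case True
    then obtain u v where uv: "a = u + k" "b = v + l" by blast
    have d: "d = l + k" using that by (simp add: splits_def add.commute)
    have e: "u + k + (v + l) - (l + k) = u + v"
      by (intro poly_mapping_eqI) (simp add: lookup_add lookup_minus)
    have f: "of_nat (mbinom (l + k) k) * (mfact k * mfact l) = (mfact (l + k) :: 'b)"
      by (simp add: mbinom_mfact)
    have "of_nat (mbinom (l + k) k) * (mfact k * of_nat (mbinom (u + k) k) * c) * (mfact l * of_nat (mbinom (v + l) l) * e)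
      = (of_nat (mbinom (l + k) k) * (mfact k * mfact l)) * (of_nat (mbinom (u + k) k * mbinom (v + l) l)) * (c * e)"
      by (simp add: algebra_simps)
    then have g: "of_nat (mbinom (l + k) k) * (mfact k * of_nat (mbinom (u + k) k) * c) * (mfact l * of_nat (mbinom (v + l) l) * e)
      = mfact (l + k) * of_nat (mbinom (u + k) k * mbinom (v + l) l) * (c * e)"
      by (simp only: f)
    show ?thesis
      unfolding uv mderiv_single d e of_nat_mult_single add_diff_cancel_right' g ..
  next
    case False
    then have "mbinom a k = 0 \<or> mbinom b l = 0" using mbinom_eq_0[of k a] mbinom_eq_0[of l b] by metis
    then show ?thesis
    proof
      assume "mbinom a k = 0"
      then show ?thesis unfolding mderiv_single by simp
    next
      assume "mbinom b l = 0"
      then show ?thesis unfolding mderiv_single by simp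
    qed
  qed
  have "(\<Sum>(k, l)\<in>splits d. of_nat (mbinom d k) * mderiv k (Poly_Mapping.single a c) * mderiv l (Poly_Mapping.single b e))
    = (\<Sum>(k, l)\<in>splits d. Poly_Mapping.single (a + b - d) (mfact d * of_nat (mbinom a k * mbinom b l) * (c * e)))"
    by (intro sum.cong refl) (auto simp: *)
  also have "\<dots> = Poly_Mapping.single (a + b - d) (mfact d * of_nat (mbinom (a + b) d) * (c * e))"
    unfolding mbinom_vandermonde of_nat_sum sum_distrib_left sum_distrib_right single_sum case_prod_beta ..
  finally show ?thesis unfolding mult_single mderiv_single by simp
qed

lemma mderiv_mult:
  "mderiv d (p * q) = (\<Sum>(k, l)\<in>splits d. of_nat (mbinom d k) * mderiv k p * mderiv l q)"
proof -
  let ?P = "\<lambda>a. Poly_Mapping.single a (Poly_Mapping.lookup p a)"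
  let ?Q = "\<lambda>a. Poly_Mapping.single a (Poly_Mapping.lookup q a)"
  have "mderiv d (p * q) = mderiv d ((\<Sum>a\<in>Poly_Mapping.keys p. ?P a) * (\<Sum>b\<in>Poly_Mapping.keys q. ?Q b))"
    by (simp flip: mpolynomial_sum_single)
  also have "\<dots> = (\<Sum>a\<in>Poly_Mapping.keys p. \<Sum>b\<in>Poly_Mapping.keys q. \<Sum>(k, l)\<in>splits d.
       of_nat (mbinom d k) * mderiv k (?P a) * mderiv l (?Q b))"
    by (simp add: sum_product mderiv_sum mderiv_mult_single)
  also have "\<dots> = (\<Sum>(k, l)\<in>splits d. \<Sum>a\<in>Poly_Mapping.keys p. \<Sum>b\<in>Poly_Mapping.keys q.
       of_nat (mbinom d k) * mderiv k (?P a) * mderiv l (?Q b))"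
    by (simp add: case_prod_beta sum.swap[of _ "splits d"])
  also have "\<dots> = (\<Sum>(k, l)\<in>splits d. of_nat (mbinom d k) *
       mderiv k (\<Sum>a\<in>Poly_Mapping.keys p. ?P a) * mderiv l (\<Sum>b\<in>Poly_Mapping.keys q. ?Q b))"
    unfolding mderiv_sum mult.assoc sum_product by (simp only: sum_distrib_left)
  finally show ?thesis by (simp flip: mpolynomial_sum_single)
qed


section \<open>The semicompleted Weyl algebra\<close>

text \<open>An element is a formal series \<open>\<Sum>\<^sub>b p\<^sub>b \<partial>\<^sup>b\<close> over all multi-indices \<open>b\<close> with polynomial coefficients
  \<open>p\<^sub>b\<close> in the \<open>x\<^sub>i\<close> to the left; it is stored as the family \<open>b \<mapsto> p\<^sub>b\<close>.\<close>

typedef (overloaded) ('n, 'k::zero) weyl = "UNIV :: ('n mindex \<Rightarrow> ('n, 'k) mpolynomial) set"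
  morphisms weyl_coeff Weyl
  by simp

setup_lifting type_definition_weyl

lemma weyl_eqI: "(\<And>b. weyl_coeff A b = weyl_coeff B b) \<Longrightarrow> A = B"
  by transfer auto

instantiation weyl :: (type, ab_group_add) ab_group_add
begin

lift_definition zero_weyl :: "('a, 'b) weyl" is "\<lambda>_. 0" .
lift_definition plus_weyl :: "('a, 'b) weyl \<Rightarrow> ('a, 'b) weyl \<Rightarrow> ('a, 'b) weyl" is "\<lambda>p q b. p b + q b" .
lift_definition minus_weyl :: "('a, 'b) weyl \<Rightarrow> ('a, 'b) weyl \<Rightarrow> ('a, 'b) weyl" is "\<lambda>p q b. p b - q b" .
lift_definition uminus_weyl :: "('a, 'b) weyl \<Rightarrow> ('a, 'b) weyl" is "\<lambda>p b. - p b" .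

instance by standard (transfer, simp add: fun_eq_iff algebra_simps)+

end

text \<open>The product is forced by the Leibniz rule
  \<open>\<partial>\<^sup>b q = \<Sum>\<^sub>k (b choose k) (\<partial>\<^sup>k q) \<partial>\<^sup>(\<^sup>b\<^sup>-\<^sup>k\<^sup>)\<close>. With \<open>b = e + k\<close>, the coefficient of \<open>\<partial>\<^sup>d\<close> in
  \<open>(\<Sum>\<^sub>b p\<^sub>b \<partial>\<^sup>b) (\<Sum>\<^sub>c q\<^sub>c \<partial>\<^sup>c)\<close> collects the terms with \<open>c + e = d\<close>. The sum over \<open>k\<close> has finite support
  because \<open>q\<^sub>c\<close> is a polynomial (lemma \<open>finite_mderiv\<close>).\<close>

instantiation weyl :: (finite, field_char_0) "{one, times}"
begin

lift_definition one_weyl :: "('a, 'b) weyl" is "\<lambda>b. if b = 0 then 1 else 0" .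
lift_definition times_weyl :: "('a, 'b) weyl \<Rightarrow> ('a, 'b) weyl \<Rightarrow> ('a, 'b) weyl" is
  "\<lambda>p q d. \<Sum>(c, e)\<in>splits d. Sum_any (\<lambda>k. of_nat (mbinom (e + k) k) * p (e + k) * mderiv k (q c))" .

instance ..

end

text \<open>Action by differential operators on polynomials; it is faithful, and is used to verify the
  ring axioms.\<close>

definition weyl_act :: "('n::finite, 'k::field_char_0) weyl \<Rightarrow> ('n, 'k) mpolynomial \<Rightarrow> ('n, 'k) mpolynomial" where
  "weyl_act A f = Sum_any (\<lambda>b. weyl_coeff A b * mderiv b f)"

lemma finite_weyl_act: "finite {b. p b * mderiv b f \<noteq> 0}"
  by (rule finite_subset[OF _ finite_mderiv[of f]]) auto

lemma weyl_act_add: "weyl_act (A + B) f = weyl_act A f + weyl_act B f"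
  unfolding weyl_act_def
  by (subst Sum_any.distrib[symmetric]) (auto simp: finite_weyl_act plus_weyl.rep_eq distrib_right)

lemma weyl_act_zero: "weyl_act 0 f = 0"
  by (simp add: weyl_act_def zero_weyl.rep_eq)

lemma weyl_act_diff: "weyl_act (A - B) f = weyl_act A f - weyl_act B f"
  using weyl_act_add[of "A - B" B f] by simp

lemma weyl_act_add_right: "weyl_act A (f + g) = weyl_act A f + weyl_act A g"
  unfolding weyl_act_def
  by (subst Sum_any.distrib[symmetric]) (auto simp: finite_weyl_act mderiv_add distrib_left)

lemma weyl_act_single:
  assumes "\<And>b. weyl_coeff A b = (if b = c then p else 0)"
  shows "weyl_act A f = p * mderiv c f"
proof -
  have "weyl_act A f = Sum_any (\<lambda>b. p * mderiv b f when b = c)"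
    unfolding weyl_act_def by (intro arg_cong[where f = Sum_any]) (auto simp: assms when_def)
  then show ?thesis by simp
qed

lemma weyl_act_one: "weyl_act 1 f = f"
  by (subst weyl_act_single[where c = 0 and p = 1]) (auto simp: one_weyl.rep_eq)

lemma weyl_act_eq_0:
  assumes "\<And>f. weyl_act A f = 0"
  shows "A = 0"
proof -
  have "weyl_coeff A b = 0" for b
  proof (induction "\<Sum>i\<in>UNIV. Poly_Mapping.lookup b i" arbitrary: b rule: less_induct)
    case less
    have "0 = weyl_act A (Poly_Mapping.single b 1)" by (simp add: assms)
    also have "\<dots> = Sum_any (\<lambda>c. weyl_coeff A c * mderiv c (Poly_Mapping.single b 1) when c = b)"
      unfolding weyl_act_def
    proof (rule arg_cong[where f = Sum_any], rule ext)
      fix c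
      show "weyl_coeff A c * mderiv c (Poly_Mapping.single b 1) =
        (weyl_coeff A c * mderiv c (Poly_Mapping.single b 1) when c = b)"
      proof (cases "c = b")
        case False
        show ?thesis
        proof (cases "\<exists>a. a + c = b")
          case True
          then obtain a where a: "a + c = b" by blast
          with False have "a \<noteq> 0" by auto
          then obtain i where "Poly_Mapping.lookup a i \<noteq> 0"
            by (metis lookup_zero poly_mapping_eqI)
          then have "0 < (\<Sum>i\<in>UNIV. Poly_Mapping.lookup a i)"
            by (metis (mono_tags, lifting) UNIV_I finite gr0I sum_eq_0_iff)
          then have "weyl_coeff A c = 0"
            by (intro less) (simp add: lookup_add sum.distrib flip: a)
          then show ?thesis by simp
        next
          case False
          then show ?thesis using mbinom_eq_0[OF False] \<open>c \<noteq> b\<close> by (simp add: mderiv_single)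
        qed
      qed simp
    qed
    also have "\<dots> = weyl_coeff A b * mderiv b (Poly_Mapping.single b 1)" by simp
    also have "mderiv b (Poly_Mapping.single b 1) = Poly_Mapping.single 0 (mfact b :: 'b)"
      by (simp add: mderiv_single mbinom_def)
    finally have eq: "weyl_coeff A b * Poly_Mapping.single 0 (mfact b) = 0" by simp
    have "weyl_coeff A b = weyl_coeff A b * Poly_Mapping.single 0 (mfact b) * Poly_Mapping.single 0 (1 / mfact b)"
      by (simp add: mult.assoc mult_single)
    then show ?case by (simp add: eq)
  qed
  then show ?thesis by (intro weyl_eqI) (simp add: zero_weyl.rep_eq)
qed

lemma weyl_act_eqI: "(\<And>f. weyl_act A f = weyl_act B f) \<Longrightarrow> A = B"
  using weyl_act_eq_0[of "A - B"] by (simp add: weyl_act_diff)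

lemma Sum_any_splits:
  fixes h :: "'n::finite mindex \<Rightarrow> 'n mindex \<Rightarrow> 'c::comm_monoid_add"
  assumes fin: "finite {(a, b). h a b \<noteq> 0}"
  shows "Sum_any (\<lambda>d. \<Sum>(a, b)\<in>splits d. h a b) = Sum_any (\<lambda>(a, b). h a b)"
proof -
  define S where "S = {(a, b). h a b \<noteq> 0}"
  define T where "T = (\<lambda>(a, b). a + b) ` S"
  have S: "finite S" and T: "finite T" using fin by (auto simp: S_def T_def)
  have "Sum_any (\<lambda>d. \<Sum>(a, b)\<in>splits d. h a b) = (\<Sum>d\<in>T. \<Sum>(a, b)\<in>splits d. h a b)"
  proof (rule Sum_any.expand_superset[OF T], rule subsetI)
    fix d assume "d \<in> {d. (\<Sum>(a, b)\<in>splits d. h a b) \<noteq> 0}"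
    then have "(\<Sum>(a, b)\<in>splits d. h a b) \<noteq> 0" by simp
    then obtain p where p: "p \<in> splits d" "(case p of (a, b) \<Rightarrow> h a b) \<noteq> 0"
      by (rule sum.not_neutral_contains_not_neutral)
    obtain a b where ab: "p = (a, b)" by (cases p)
    have "(a, b) \<in> S" "d = (case (a, b) of (a, b) \<Rightarrow> a + b)"
      using p by (simp_all add: ab S_def splits_def)
    then show "d \<in> T" unfolding T_def by blast
  qed
  also have "\<dots> = (\<Sum>(d, a, b)\<in>Sigma T splits. h a b)"
    by (subst sum.Sigma) (auto simp: T case_prod_beta)
  also have "\<dots> = (\<Sum>(d, a, b)\<in>(\<lambda>(a, b). (a + b, a, b)) ` S. h a b)"
  proof (rule sum.mono_neutral_right)
    show "finite (Sigma T splits)" using T by simp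
    show "(\<lambda>(a, b). (a + b, a, b)) ` S \<subseteq> Sigma T splits"
      by (auto simp: T_def splits_def)
    show "\<forall>x\<in>Sigma T splits - (\<lambda>(a, b). (a + b, a, b)) ` S. (case x of (d, a, b) \<Rightarrow> h a b) = 0"
      by (auto simp: S_def splits_def image_iff)
  qed
  also have "\<dots> = (\<Sum>(a, b)\<in>S. h a b)"
    by (subst sum.reindex) (auto simp: inj_on_def case_prod_beta)
  also have "(\<Sum>(a, b)\<in>S. h a b) = Sum_any (\<lambda>(a, b). h a b)"
  proof -
    have "{p. (case p of (a, b) \<Rightarrow> h a b) \<noteq> 0} \<subseteq> S" by (auto simp: S_def)
    from Sum_any.expand_superset[OF S this] show ?thesis by simp
  qed
  finally show ?thesis .
qed

lemma weyl_coeff_times_term: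
  "weyl_coeff (A * B) d * f =
    (\<Sum>(c, e)\<in>splits d. Sum_any (\<lambda>k. of_nat (mbinom (e + k) k) * weyl_coeff A (e + k) * mderiv k (weyl_coeff B c) * f))"
  unfolding times_weyl.rep_eq sum_distrib_right case_prod_beta
proof (intro sum.cong refl)
  fix z :: "'a mindex \<times> 'a mindex"
  have "finite {k. of_nat (mbinom (snd z + k) k) * weyl_coeff A (snd z + k) * mderiv k (weyl_coeff B (fst z)) \<noteq> 0}"
    by (rule finite_subset[OF _ finite_mderiv[of "weyl_coeff B (fst z)"]]) auto
  then show "Sum_any (\<lambda>k. of_nat (mbinom (snd z + k) k) * weyl_coeff A (snd z + k) * mderiv k (weyl_coeff B (fst z))) * f =
    Sum_any (\<lambda>k. of_nat (mbinom (snd z + k) k) * weyl_coeff A (snd z + k) * mderiv k (weyl_coeff B (fst z)) * f)"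
    by (rule Sum_any_left_distrib)
qed

lemma weyl_act_times: "weyl_act (A * B) f = weyl_act A (weyl_act B f)"
proof -
  define G where "G = (\<lambda>c e k. of_nat (mbinom (e + k) k) * weyl_coeff A (e + k) *
    mderiv k (weyl_coeff B c) * mderiv (c + e) f)"
  define S where "S = {p. mderiv (fst p + snd p) f \<noteq> 0}"
  have "S \<subseteq> (\<Union>d\<in>{d. mderiv d f \<noteq> 0}. splits d)" by (auto simp: S_def splits_def)
  then have finS: "finite S" by (rule finite_subset) (auto intro: finite_mderiv)
  define T where "T = (\<Union>p\<in>S. {k. mderiv k (weyl_coeff B (fst p)) \<noteq> 0})"
  have finT: "finite T" using finS by (auto simp: T_def intro: finite_mderiv)
  have G0: "(c, e) \<in> S \<and> k \<in> T" if "G c e k \<noteq> 0" for c e k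
  proof -
    have "mderiv k (weyl_coeff B c) \<noteq> 0" "mderiv (c + e) f \<noteq> 0"
      using that by (auto simp: G_def)
    then show ?thesis by (auto simp: S_def T_def)
  qed
  have "weyl_act (A * B) f = Sum_any (\<lambda>d. \<Sum>(c, e)\<in>splits d. Sum_any (\<lambda>k. G c e k))"
    unfolding weyl_act_def weyl_coeff_times_term
    by (intro arg_cong[where f = Sum_any] ext sum.cong refl) (auto simp: G_def splits_def)
  also have "\<dots> = Sum_any (\<lambda>(c, e). Sum_any (\<lambda>k. G c e k))"
  proof (rule Sum_any_splits, rule finite_subset[OF _ finS], rule subsetI)
    fix p assume "p \<in> {(c, e). Sum_any (\<lambda>k. G c e k) \<noteq> 0}"
    then obtain c e where p: "p = (c, e)" "Sum_any (\<lambda>k. G c e k) \<noteq> 0" by blast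
    then obtain k where "G c e k \<noteq> 0" by (metis Sum_any.not_neutral_obtains_not_neutral)
    then show "p \<in> S" using G0 p(1) by blast
  qed
  also have "\<dots> = (\<Sum>(c, e)\<in>S. Sum_any (\<lambda>k. G c e k))"
  proof (rule Sum_any.expand_superset[OF finS], rule subsetI)
    fix p assume "p \<in> {p. (case p of (c, e) \<Rightarrow> Sum_any (\<lambda>k. G c e k)) \<noteq> 0}"
    then obtain c e where p: "p = (c, e)" "Sum_any (\<lambda>k. G c e k) \<noteq> 0" by (cases p) auto
    then obtain k where "G c e k \<noteq> 0" by (metis Sum_any.not_neutral_obtains_not_neutral)
    then show "p \<in> S" using G0 p(1) by blast
  qed
  also have "\<dots> = (\<Sum>(c, e)\<in>S. \<Sum>k\<in>T. G c e k)"
    unfolding case_prod_beta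
    by (intro sum.cong refl Sum_any.expand_superset finT) (use G0 in auto)
  also have "\<dots> = (\<Sum>((c, e), k)\<in>S \<times> T. G c e k)"
    by (simp add: sum.cartesian_product case_prod_beta)
  finally have L: "weyl_act (A * B) f = (\<Sum>((c, e), k)\<in>S \<times> T. G c e k)" .

  define U where "U = fst ` S"
  define V where "V = snd ` S"
  have finU: "finite U" and finV: "finite V" using finS by (auto simp: U_def V_def)
  have fin: "finite {c. weyl_coeff B c * mderiv c f \<noteq> 0}" by (rule finite_weyl_act)
  have "{c. weyl_coeff B c * mderiv c f \<noteq> 0} \<subseteq> U"
  proof
    fix c assume "c \<in> {c. weyl_coeff B c * mderiv c f \<noteq> 0}"
    then have "(c, 0) \<in> S" by (auto simp: S_def)
    then show "c \<in> U" by (force simp: U_def)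
  qed
  then have actB: "weyl_act B f = (\<Sum>c\<in>U. weyl_coeff B c * mderiv c f)"
    unfolding weyl_act_def by (rule Sum_any.expand_superset[OF finU])
  define H where "H = (\<lambda>k e. \<Sum>c\<in>U. G c e k)"
  have tm: "weyl_coeff A b * mderiv b (weyl_act B f) = (\<Sum>(k, e)\<in>splits b. H k e)" for b
  proof -
    have "weyl_coeff A b * mderiv b (weyl_act B f) =
      (\<Sum>c\<in>U. \<Sum>(k, e)\<in>splits b. weyl_coeff A b * (of_nat (mbinom b k) * mderiv k (weyl_coeff B c) * mderiv e (mderiv c f)))"
      unfolding actB mderiv_sum mderiv_mult sum_distrib_left case_prod_beta ..
    also have "\<dots> = (\<Sum>c\<in>U. \<Sum>(k, e)\<in>splits b. G c e k)"
    proof (intro sum.cong refl, goal_cases)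
      case (1 c z)
      then obtain k e where z: "z = (k, e)" "b = e + k" by (auto simp: splits_def add.commute)
      have m: "mderiv e (mderiv c f) = mderiv (c + e) f" by (simp add: mderiv_mderiv add.commute)
      show ?case by (simp only: z case_prod_conv G_def m) (simp add: mult_ac)
    qed
    also have "\<dots> = (\<Sum>(k, e)\<in>splits b. H k e)"
      unfolding H_def case_prod_beta by (rule sum.swap)
    finally show ?thesis .
  qed
  have subset: "{(k, e). H k e \<noteq> 0} \<subseteq> T \<times> V"
  proof
    fix p assume "p \<in> {(k, e). H k e \<noteq> 0}"
    then obtain k e where p: "p = (k, e)" "H k e \<noteq> 0" by blast
    then obtain c where "G c e k \<noteq> 0"
      unfolding H_def by (metis sum.not_neutral_contains_not_neutral)
    from G0[OF this] show "p \<in> T \<times> V" by (force simp: p(1) V_def)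
  qed
  have finH: "finite {(k, e). H k e \<noteq> 0}"
    by (rule finite_subset[OF subset]) (simp add: finT finV)
  have "weyl_act A (weyl_act B f) = Sum_any (\<lambda>b. \<Sum>(k, e)\<in>splits b. H k e)"
    unfolding weyl_act_def[of A] tm ..
  also have "\<dots> = Sum_any (\<lambda>(k, e). H k e)"
    by (rule Sum_any_splits[OF finH])
  also have "\<dots> = (\<Sum>(k, e)\<in>T \<times> V. H k e)"
    by (rule Sum_any.expand_superset) (use finT finV subset in auto)
  also have "\<dots> = (\<Sum>((k, e), c)\<in>(T \<times> V) \<times> U. G c e k)"
    by (simp add: H_def sum.cartesian_product case_prod_beta)
  also have "\<dots> = (\<Sum>((c, e), k)\<in>(U \<times> V) \<times> T. G c e k)"
    by (rule sum.reindex_bij_witness[where i = "\<lambda>((c, e), k). ((k, e), c)" and j = "\<lambda>((k, e), c). ((c, e), k)"]) auto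
  also have "\<dots> = (\<Sum>((c, e), k)\<in>S \<times> T. G c e k)"
  proof (rule sum.mono_neutral_right)
    show "finite ((U \<times> V) \<times> T)" using finU finV finT by simp
    show "S \<times> T \<subseteq> (U \<times> V) \<times> T" by (force simp: U_def V_def)
    show "\<forall>x\<in>(U \<times> V) \<times> T - S \<times> T. (case x of (x, k) \<Rightarrow> (case x of (c, e) \<Rightarrow> \<lambda>k. G c e k) k) = 0"
      using G0 by fastforce
  qed
  finally show ?thesis using L by simp
qed

instance weyl :: (finite, field_char_0) ring_1
proof
  fix A B C :: "('a, 'b) weyl"
  show "A * B * C = A * (B * C)" by (rule weyl_act_eqI) (simp add: weyl_act_times)
  show "(A + B) * C = A * C + B * C" by (rule weyl_act_eqI) (simp add: weyl_act_times weyl_act_add)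
  show "A * (B + C) = A * B + A * C"
    by (rule weyl_act_eqI) (simp add: weyl_act_times weyl_act_add weyl_act_add_right)
  show "1 * A = A" by (rule weyl_act_eqI) (simp add: weyl_act_times weyl_act_one)
  show "A * 1 = A" by (rule weyl_act_eqI) (simp add: weyl_act_times weyl_act_one)
  have "weyl_coeff (0 :: ('a, 'b) weyl) 0 \<noteq> weyl_coeff 1 0"
    by (simp add: zero_weyl.rep_eq one_weyl.rep_eq)
  then show "(0 :: ('a, 'b) weyl) \<noteq> 1" by metis
qed

lift_definition weyl_scale :: "'k::field_char_0 \<Rightarrow> ('n, 'k) weyl \<Rightarrow> ('n, 'k) weyl"
  is "\<lambda>r p b. Poly_Mapping.map ((*) r) (p b)" .

definition weyl_x :: "'n \<Rightarrow> ('n::finite, 'k::field_char_0) weyl" where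
  "weyl_x i = Weyl (\<lambda>b. if b = 0 then Poly_Mapping.single (Poly_Mapping.single i 1) 1 else 0)"

definition weyl_d :: "'n \<Rightarrow> ('n::finite, 'k::field_char_0) weyl" where
  "weyl_d i = Weyl (\<lambda>b. if b = Poly_Mapping.single i 1 then 1 else 0)"

definition commutator :: "'r::ring \<Rightarrow> 'r \<Rightarrow> 'r" where
  "commutator a b = a * b - b * a"

lemma weyl_act_x: "weyl_act (weyl_x i) f = Poly_Mapping.single (Poly_Mapping.single i 1) 1 * f"
  by (subst weyl_act_single) (auto simp: weyl_x_def Weyl_inverse)

lemma weyl_act_d: "weyl_act (weyl_d i) f = mderiv (Poly_Mapping.single i 1) f"
  by (subst weyl_act_single) (auto simp: weyl_d_def Weyl_inverse)

lemma Poly_Mapping_map_times: "Poly_Mapping.map ((*) r) p = Poly_Mapping.single 0 r * p"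
  for p :: "('n, 'k::field_char_0) mpolynomial"
proof (rule poly_mapping_eqI)
  fix b
  have "Poly_Mapping.single 0 r * p = (\<Sum>a\<in>Poly_Mapping.keys p. Poly_Mapping.single a (r * Poly_Mapping.lookup p a))"
    by (subst mpolynomial_sum_single[of p]) (simp add: sum_distrib_left mult_single)
  then show "Poly_Mapping.lookup (Poly_Mapping.map ((*) r) p) b = Poly_Mapping.lookup (Poly_Mapping.single 0 r * p) b"
    by (auto simp: lookup_sum lookup_single when_def in_keys_iff map.rep_eq)
qed

lemma weyl_act_scale: "weyl_act (weyl_scale r A) f = Poly_Mapping.single 0 r * weyl_act A f"
  unfolding weyl_act_def weyl_scale.rep_eq Poly_Mapping_map_times mult.assoc
  by (rule Sum_any_right_distrib[symmetric]) (rule finite_weyl_act)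

lemma weyl_scale_times_left: "weyl_scale r A * B = weyl_scale r (A * B)"
  by (rule weyl_act_eqI) (simp add: weyl_act_times weyl_act_scale)

lemma weyl_commutation_relations:
  fixes i j :: "'n::finite"
  shows "commutator (weyl_x i :: ('n, 'k::field_char_0) weyl) (weyl_x j) = 0"
    and "commutator (weyl_d i :: ('n, 'k) weyl) (weyl_d j) = 0"
    and "commutator (weyl_d i :: ('n, 'k) weyl) (weyl_x j) = (if i = j then 1 else 0)"
proof -
  show "commutator (weyl_x i :: ('n, 'k) weyl) (weyl_x j) = 0"
    unfolding commutator_def
    by (rule weyl_act_eqI) (simp add: weyl_act_diff weyl_act_times weyl_act_zero weyl_act_x mult_ac)
  show "commutator (weyl_d i :: ('n, 'k) weyl) (weyl_d j) = 0"
    unfolding commutator_def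
    by (rule weyl_act_eqI) (simp add: weyl_act_diff weyl_act_times weyl_act_zero weyl_act_d mderiv_mderiv add.commute)
  let ?s = "\<lambda>i::'n. Poly_Mapping.single i (1::nat)"
  have splits: "splits (?s i) = {(?s i, 0), (0, ?s i)}"
  proof -
    have "(a = ?s i \<and> b = 0) \<or> (a = 0 \<and> b = ?s i)" if "a + b = ?s i" for a b
    proof -
      have l: "Poly_Mapping.lookup a k + Poly_Mapping.lookup b k = (if k = i then 1 else 0)" for k
        using arg_cong[OF that, of "\<lambda>c. Poly_Mapping.lookup c k"]
        by (auto simp: lookup_add lookup_single when_def)
      show ?thesis
      proof (cases "Poly_Mapping.lookup a i = 0")
        case True
        have "Poly_Mapping.lookup a k = 0" for k
          using l[of k] True by (cases "k = i") simp_all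
        then have "a = 0" by (intro poly_mapping_eqI) simp
        then show ?thesis using that by simp
      next
        case False
        have "Poly_Mapping.lookup b k = 0" for k
          using l[of k] False by (cases "k = i") simp_all
        then have "b = 0" by (intro poly_mapping_eqI) simp
        then show ?thesis using that by simp
      qed
    qed
    then show ?thesis by (auto simp: splits_def)
  qed
  have ne: "?s i \<noteq> 0" by (metis lookup_single_eq lookup_zero zero_neq_one)
  have self: "mbinom a a = 1" and zero: "mbinom a 0 = 1" for a :: "'n mindex"
    by (simp_all add: mbinom_def)
  have fact1: "mfact (?s i) = (1 :: 'k)" for i
    by (auto simp: mfact_def lookup_single when_def intro!: prod.neutral)
  have other: "mbinom (?s j) (?s i) = 0" if "i \<noteq> j"
    unfolding mbinom_def by (rule prod_zero) (use that in \<open>auto simp: lookup_single when_def\<close>)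
  have "mderiv (?s i) (Poly_Mapping.single (?s j) 1 * f) =
      (if i = j then f else 0) + Poly_Mapping.single (?s j) 1 * mderiv (?s i) f"
    for f :: "('n, 'k) mpolynomial"
  proof -
    have "mderiv (?s i) (Poly_Mapping.single (?s j) (1::'k)) = (if i = j then 1 else 0)"
      using other by (simp add: mderiv_single fact1[simplified] self)
    then show ?thesis
      unfolding mderiv_mult splits using ne by (simp add: self zero)
  qed
  then show "commutator (weyl_d i) (weyl_x j) = (if i = j then 1 else 0 :: ('n, 'k) weyl)"
    unfolding commutator_def
    by (intro weyl_act_eqI)
      (simp add: weyl_act_diff weyl_act_times weyl_act_zero weyl_act_one weyl_act_d weyl_act_x)
qed


section \<open>Power series evaluated at matrices over the Weyl algebra\<close>

text \<open>Sum of a sequence in which every coefficient of \<open>\<partial>\<^sup>b\<close> receives only finitely many nonzero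
  contributions.\<close>

definition weyl_sum :: "(nat \<Rightarrow> ('n, 'k::comm_monoid_add) weyl) \<Rightarrow> ('n, 'k) weyl" where
  "weyl_sum f = Weyl (\<lambda>b. Sum_any (\<lambda>k. weyl_coeff (f k) b))"

text \<open>The power operation on \<^typ>\<open>'a ^ 'm ^ 'm\<close> from the library is the componentwise one.\<close>

primrec matrix_pow :: "'a::semiring_1 ^ 'm ^ 'm \<Rightarrow> nat \<Rightarrow> 'a ^ 'm ^ 'm" where
  "matrix_pow M 0 = mat 1"
| "matrix_pow M (Suc k) = M ** matrix_pow M k"

definition matrix_fps :: "'k fps \<Rightarrow> ('n::finite, 'k::field_char_0) weyl ^ 'm ^ 'm \<Rightarrow> ('n, 'k) weyl ^ 'm ^ 'm" where
  "matrix_fps F M = (\<chi> i j. weyl_sum (\<lambda>k. weyl_scale (fps_nth F k) (matrix_pow M k $ i $ j)))"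

definition structure_matrix ::
    "('n \<Rightarrow> 'n \<Rightarrow> 'n \<Rightarrow> 'k) \<Rightarrow> ('n::finite, 'k::field_char_0) weyl ^ 'n ^ 'n" where
  "structure_matrix C = (\<chi> i j. \<Sum>a\<in>UNIV. weyl_scale (C i a j) (weyl_d a))"

text \<open>The powers of the structure matrix can be summed against arbitrary coefficients.\<close>

definition d_series :: "nat \<Rightarrow> ('n::finite, 'k::field_char_0) weyl \<Rightarrow> bool" where
  "d_series k A \<longleftrightarrow> (\<forall>b. \<exists>r. weyl_coeff A b = Poly_Mapping.single 0 r \<and>
     ((\<Sum>i\<in>UNIV. Poly_Mapping.lookup b i) < k \<longrightarrow> r = 0))"

lemma d_series_0: "d_series k 0"
  unfolding d_series_def zero_weyl.rep_eq by (metis single_zero)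

lemma d_series_add:
  assumes "d_series k A" "d_series k B" shows "d_series k (A + B)"
  unfolding d_series_def plus_weyl.rep_eq
proof
  fix b
  from assms obtain r s where
    "weyl_coeff A b = Poly_Mapping.single 0 r" "weyl_coeff B b = Poly_Mapping.single 0 s"
    "(\<Sum>i\<in>UNIV. Poly_Mapping.lookup b i) < k \<longrightarrow> r = 0 \<and> s = 0"
    unfolding d_series_def by metis
  then show "\<exists>r. weyl_coeff A b + weyl_coeff B b = Poly_Mapping.single 0 r \<and>
      ((\<Sum>i\<in>UNIV. Poly_Mapping.lookup b i) < k \<longrightarrow> r = 0)"
    by (intro exI[of _ "r + s"]) (simp add: single_add)
qed

lemma d_series_sum: "(\<And>s. s \<in> S \<Longrightarrow> d_series k (f s)) \<Longrightarrow> d_series k (sum f S)"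
  by (induction S rule: infinite_finite_induct) (auto simp: d_series_0 d_series_add)

lemma d_series_times:
  assumes A: "d_series k A" and B: "d_series l B" shows "d_series (k + l) (A * B)"
proof -
  define p where "p = (\<lambda>b. Poly_Mapping.lookup (weyl_coeff A b) 0)"
  define q where "q = (\<lambda>b. Poly_Mapping.lookup (weyl_coeff B b) 0)"
  have p: "weyl_coeff A b = Poly_Mapping.single 0 (p b)" for b
    using A unfolding d_series_def p_def by (metis lookup_single_eq)
  have q: "weyl_coeff B b = Poly_Mapping.single 0 (q b)" for b
    using B unfolding d_series_def q_def by (metis lookup_single_eq)
  have p0: "p b = 0" if "(\<Sum>i\<in>UNIV. Poly_Mapping.lookup b i) < k" for b
    using A that unfolding d_series_def p_def by (metis lookup_single_eq)
  have q0: "q b = 0" if "(\<Sum>i\<in>UNIV. Poly_Mapping.lookup b i) < l" for b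
    using B that unfolding d_series_def q_def by (metis lookup_single_eq)
  have "Sum_any (\<lambda>j. of_nat (mbinom (e + j) j) * weyl_coeff A (e + j) * mderiv j (weyl_coeff B c))
      = Poly_Mapping.single 0 (p e * q c)" for c e
  proof -
    have "of_nat (mbinom (e + j) j) * weyl_coeff A (e + j) * mderiv j (weyl_coeff B c)
        = (Poly_Mapping.single 0 (p e * q c) when j = 0)" for j
    proof (cases "j = 0")
      case True
      have "mbinom e 0 = 1" by (simp add: mbinom_def)
      then show ?thesis by (simp add: True p q mult_single)
    next
      case False
      then have "\<nexists>d. d + j = 0"
        by (metis add_eq_0_iff_both_eq_0 lookup_add lookup_zero poly_mapping_eqI)
      then have "mderiv j (weyl_coeff B c) = 0"
        unfolding q mderiv_single using mbinom_eq_0[of j 0] by simp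
      with False show ?thesis by simp
    qed
    then show ?thesis by simp
  qed
  then have coeff: "weyl_coeff (A * B) d = Poly_Mapping.single 0 (\<Sum>(c, e)\<in>splits d. p e * q c)" for d
    unfolding times_weyl.rep_eq single_sum case_prod_beta by simp
  show ?thesis
    unfolding d_series_def
  proof
    fix d
    have "(\<Sum>(c, e)\<in>splits d. p e * q c) = 0" if "(\<Sum>i\<in>UNIV. Poly_Mapping.lookup d i) < k + l"
    proof (intro sum.neutral ballI)
      fix z assume "z \<in> splits d"
      then obtain c e where z: "z = (c, e)" "d = c + e" by (auto simp: splits_def)
      have "(\<Sum>i\<in>UNIV. Poly_Mapping.lookup c i) < l \<or> (\<Sum>i\<in>UNIV. Poly_Mapping.lookup e i) < k"
        using that by (simp add: z lookup_add sum.distrib) linarith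
      then show "(case z of (c, e) \<Rightarrow> p e * q c) = 0" using p0 q0 by (auto simp: z(1))
    qed
    with coeff show "\<exists>r. weyl_coeff (A * B) d = Poly_Mapping.single 0 r \<and>
      ((\<Sum>i\<in>UNIV. Poly_Mapping.lookup d i) < k + l \<longrightarrow> r = 0)" by blast
  qed
qed

lemma d_series_structure_matrix: "d_series 1 (structure_matrix C $ i $ j)"
proof -
  have "d_series 1 (weyl_scale r (weyl_d a))" for r :: 'b and a :: 'a
    unfolding d_series_def
  proof
    fix b
    have "weyl_coeff (weyl_scale r (weyl_d a)) b =
        Poly_Mapping.single 0 (if b = Poly_Mapping.single a 1 then r else 0)"
      by (simp add: weyl_scale.rep_eq weyl_d_def Weyl_inverse Poly_Mapping_map_times)
    moreover have "(\<Sum>i\<in>UNIV. Poly_Mapping.lookup (Poly_Mapping.single a (1::nat)) i) = 1"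
      by (simp add: lookup_single when_def)
    ultimately show "\<exists>s. weyl_coeff (weyl_scale r (weyl_d a)) b = Poly_Mapping.single 0 s \<and>
        ((\<Sum>i\<in>UNIV. Poly_Mapping.lookup b i) < 1 \<longrightarrow> s = 0)"
      by (intro exI[of _ "if b = Poly_Mapping.single a 1 then r else 0"]) auto
  qed
  then show ?thesis by (simp add: structure_matrix_def d_series_sum)
qed

lemma d_series_matrix_pow: "d_series k (matrix_pow (structure_matrix C) k $ i $ j)"
proof (induction k arbitrary: i j)
  case 0
  have "d_series 0 (1 :: ('a, 'b) weyl)"
    unfolding d_series_def one_weyl.rep_eq by (metis single_one single_zero less_zeroE)
  then show ?case by (simp add: mat_def d_series_0)
next
  case (Suc k)
  then show ?case
    unfolding matrix_pow.simps matrix_matrix_mult_def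
    using d_series_times[OF d_series_structure_matrix Suc, of C] by (auto intro!: d_series_sum)
qed

lemma finite_matrix_pow_structure_matrix:
  "finite {k. weyl_coeff (weyl_scale (f k) (matrix_pow (structure_matrix C) k $ i $ j)) b \<noteq> 0}"
proof (rule finite_subset)
  show "{k. weyl_coeff (weyl_scale (f k) (matrix_pow (structure_matrix C) k $ i $ j)) b \<noteq> 0}
      \<subseteq> {..(\<Sum>i\<in>UNIV. Poly_Mapping.lookup b i)}"
  proof
    fix k assume "k \<in> {k. weyl_coeff (weyl_scale (f k) (matrix_pow (structure_matrix C) k $ i $ j)) b \<noteq> 0}"
    then have "weyl_coeff (matrix_pow (structure_matrix C) k $ i $ j) b \<noteq> 0"
      by (auto simp: weyl_scale.rep_eq Poly_Mapping_map_times)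
    then show "k \<in> {..(\<Sum>i\<in>UNIV. Poly_Mapping.lookup b i)}"
      using d_series_matrix_pow[of k C i j] unfolding d_series_def by (metis atMost_iff not_le single_zero)
  qed
qed simp

lemma structure_matrix_uminus: "structure_matrix (\<lambda>i j k. - C i j k) = - structure_matrix C"
proof -
  have "weyl_scale (- r) A = - weyl_scale r A" for r and A :: "('a, 'b) weyl"
    by (rule weyl_eqI) (simp add: weyl_scale.rep_eq uminus_weyl.rep_eq Poly_Mapping_map_times single_uminus)
  then show ?thesis by (simp add: structure_matrix_def vec_eq_iff sum_negf)
qed

definition psi :: "'k::field_char_0 fps" where
  "psi = fps_X / (1 - fps_exp (-1))"

lemma psi_times: "psi * (1 - fps_exp (-1)) = fps_X"
proof -
  have n1: "fps_nth (1 - fps_exp (-1) :: 'a fps) 1 = 1" by simp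
  have "subdegree (1 - fps_exp (-1) :: 'a fps) = 1"
    by (rule subdegreeI) (use n1 in auto)
  then have "(1 - fps_exp (-1) :: 'a fps) dvd fps_X"
    by (subst fps_dvd_iff) (use n1 in auto)
  then show ?thesis unfolding psi_def by simp
qed

definition x_hat :: "('n \<Rightarrow> 'n \<Rightarrow> 'n \<Rightarrow> 'k) \<Rightarrow> 'n \<Rightarrow> ('n::finite, 'k::field_char_0) weyl" where
  "x_hat C i = (\<Sum>a\<in>UNIV. weyl_x a * matrix_fps psi (structure_matrix C) $ i $ a)"

definition T_hat :: "('n \<Rightarrow> 'n \<Rightarrow> 'n \<Rightarrow> 'k) \<Rightarrow> 'n \<Rightarrow> 'n \<Rightarrow> ('n::finite, 'k::field_char_0) weyl" where
  "T_hat C i j = matrix_fps (fps_exp 1) (structure_matrix C) $ i $ j"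

definition Tinv_hat :: "('n \<Rightarrow> 'n \<Rightarrow> 'n \<Rightarrow> 'k) \<Rightarrow> 'n \<Rightarrow> 'n \<Rightarrow> ('n::finite, 'k::field_char_0) weyl" where
  "Tinv_hat C i j = matrix_fps (fps_exp 1) (- structure_matrix C) $ i $ j"


section \<open>Algebras as records, quotients and homomorphisms\<close>

text \<open>A \<open>\<bbbK>\<close>-algebra is a ring record with an additional scalar multiplication by elements of the
  type \<open>\<bbbK>\<close>; this is the record type of \<^theory>\<open>HOL-Algebra.Module\<close>.\<close>

definition type_algebra :: "('k \<Rightarrow> 'a::ring_1 \<Rightarrow> 'a) \<Rightarrow> ('k, 'a) module" where
  "type_algebra sc = \<lparr>carrier = UNIV, monoid.mult = (*), one = 1, zero = 0, add = (+), smult = sc\<rparr>"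

definition quotient_algebra :: "('k, 'a) module \<Rightarrow> 'a set \<Rightarrow> ('k, 'a set) module" where
  "quotient_algebra R I =
    ring.extend (R Quot I) (module.fields (\<lambda>c A. \<Union>a\<in>A. I +>\<^bsub>R\<^esub> (c \<odot>\<^bsub>R\<^esub> a)))"

definition algebra_hom :: "('k, 'a) module \<Rightarrow> ('k, 'b) module \<Rightarrow> ('a \<Rightarrow> 'b) set" where
  "algebra_hom R S = {f \<in> ring_hom R S. \<forall>c. \<forall>a\<in>carrier R. f (c \<odot>\<^bsub>R\<^esub> a) = c \<odot>\<^bsub>S\<^esub> f a}"

lemma ring_type_algebra: "ring (type_algebra sc)"
proof (rule ringI)
  show "abelian_group (type_algebra sc)"
    by (rule abelian_groupI) (auto simp: type_algebra_def algebra_simps intro: exI[of _ "- x" for x])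
  show "Group.monoid (type_algebra sc)"
    by (rule monoidI) (auto simp: type_algebra_def algebra_simps)
qed (auto simp: type_algebra_def algebra_simps)


section \<open>The algebra of generators and relations\<close>

text \<open>The free unital associative algebra is the monoid algebra of the free monoid of words.\<close>

datatype 'n generator = GenX 'n | GenT 'n 'n | GenTinv 'n 'n

datatype 'a word = Word (letters: "'a list")

instantiation word :: (type) monoid_add
begin

definition "0 = Word []"
definition "u + v = Word (letters u @ letters v)"

instance by standard (simp_all add: zero_word_def plus_word_def)

end

type_synonym ('n, 'k) free_alg = "'n generator word \<Rightarrow>\<^sub>0 'k"

definition free_gen :: "'n generator \<Rightarrow> ('n, 'k::field) free_alg" where
  "free_gen g = Poly_Mapping.single (Word [g]) 1"

definition free_scale :: "'k::field \<Rightarrow> ('n, 'k) free_alg \<Rightarrow> ('n, 'k) free_alg" where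
  "free_scale c p = Poly_Mapping.map ((*) c) p"

definition free_algebra :: "('k::field, ('n, 'k) free_alg) module" where
  "free_algebra = type_algebra free_scale"

definition H_relators :: "('n \<Rightarrow> 'n \<Rightarrow> 'n \<Rightarrow> 'k) \<Rightarrow> ('n::finite, 'k::field) free_alg set" where
  "H_relators C =
    (let X = (\<lambda>i. free_gen (GenX i));
         T = (\<lambda>i j. free_gen (GenT i j));
         Tinv = (\<lambda>i j. free_gen (GenTinv i j));
         \<delta> = (\<lambda>i j. if i = j then 1 else 0)
     in {commutator (X i) (X j) - (\<Sum>a\<in>UNIV. free_scale (C i j a) (X a)) | i j. True}
      \<union> {commutator (T i j) (T k l) | i j k l. True}
      \<union> {commutator (T i j) (X k) - (\<Sum>a\<in>UNIV. free_scale (C i k a) (T a j)) | i j k. True}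
      \<union> {commutator (Tinv i j) (Tinv k l) | i j k l. True}
      \<union> {commutator (Tinv i j) (X k) - (\<Sum>a\<in>UNIV. free_scale (C k a j) (Tinv i a)) | i j k. True}
      \<union> {(\<Sum>a\<in>UNIV. Tinv i a * T a j) - \<delta> i j | i j. True}
      \<union> {(\<Sum>a\<in>UNIV. T i a * Tinv a j) - \<delta> i j | i j. True})"

definition H_ideal :: "('n \<Rightarrow> 'n \<Rightarrow> 'n \<Rightarrow> 'k) \<Rightarrow> ('n::finite, 'k::field) free_alg set" where
  "H_ideal C = genideal free_algebra (H_relators C)"

definition H_algebra :: "('n \<Rightarrow> 'n \<Rightarrow> 'n \<Rightarrow> 'k) \<Rightarrow> ('k, ('n::finite, 'k::field) free_alg set) module" where
  "H_algebra C = quotient_algebra free_algebra (H_ideal C)"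

definition H_gen :: "('n \<Rightarrow> 'n \<Rightarrow> 'n \<Rightarrow> 'k) \<Rightarrow> 'n generator \<Rightarrow> ('n::finite, 'k::field) free_alg set" where
  "H_gen C g = H_ideal C +>\<^bsub>free_algebra\<^esub> free_gen g"

definition weyl_algebra :: "('k::field_char_0, ('n::finite, 'k) weyl) module" where
  "weyl_algebra = type_algebra weyl_scale"

lemma H_ideal_ideal: "ideal (H_ideal C) free_algebra"
proof -
  interpret ring free_algebra unfolding free_algebra_def by (rule ring_type_algebra)
  show ?thesis unfolding H_ideal_def
    by (rule genideal_ideal) (simp add: free_algebra_def type_algebra_def)
qed

text \<open>The quotient is again a ring, and its scalar multiplication is the induced one.\<close>

lemma ring_H_algebra: "ring (H_algebra C)"
proof -
  interpret ideal "H_ideal C" "free_algebra :: ('b, ('a, 'b) free_alg) module" by (rule H_ideal_ideal)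
  interpret Q: ring "free_algebra Quot H_ideal C" by (rule quotient_is_ring)
  have eq: "carrier (H_algebra C) = carrier (free_algebra Quot H_ideal C)"
    "mult (H_algebra C) = mult (free_algebra Quot H_ideal C)"
    "one (H_algebra C) = one (free_algebra Quot H_ideal C)"
    "zero (H_algebra C) = zero (free_algebra Quot H_ideal C)"
    "add (H_algebra C) = add (free_algebra Quot H_ideal C)"
    by (simp_all add: H_algebra_def quotient_algebra_def ring.defs)
  show ?thesis
  proof (rule ringI)
    show "abelian_group (H_algebra C)"
      by (rule abelian_groupI) (use Q.a_assoc Q.a_comm Q.l_neg in \<open>auto simp: eq\<close>)
    show "Group.monoid (H_algebra C)"
      by (rule monoidI) (use Q.m_assoc in \<open>auto simp: eq\<close>)
  qed (auto simp: eq Q.l_distr Q.r_distr)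
qed

lemma free_scale_eq: "free_scale c p = Poly_Mapping.single 0 c * p"
proof -
  have p: "p = (\<Sum>a\<in>Poly_Mapping.keys p. Poly_Mapping.single a (Poly_Mapping.lookup p a))"
    by (intro poly_mapping_eqI) (auto simp: lookup_sum lookup_single when_def in_keys_iff)
  have "Poly_Mapping.single 0 c * p =
      (\<Sum>a\<in>Poly_Mapping.keys p. Poly_Mapping.single a (c * Poly_Mapping.lookup p a))"
    by (subst p) (simp add: sum_distrib_left mult_single)
  then show ?thesis unfolding free_scale_def
    by (intro poly_mapping_eqI) (auto simp: lookup_sum lookup_single when_def in_keys_iff map.rep_eq)
qed

lemma smult_H_algebra:
  "c \<odot>\<^bsub>H_algebra C\<^esub> (H_ideal C +>\<^bsub>free_algebra\<^esub> p) = H_ideal C +>\<^bsub>free_algebra\<^esub> free_scale c p"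
proof -
  interpret I: ideal "H_ideal C" "free_algebra :: ('b, ('a, 'b) free_alg) module" by (rule H_ideal_ideal)
  have [simp]: "carrier (free_algebra :: ('b, ('a, 'b) free_alg) module) = UNIV"
    "mult (free_algebra :: ('b, ('a, 'b) free_alg) module) = (*)"
    "add (free_algebra :: ('b, ('a, 'b) free_alg) module) = (+)"
    "smult (free_algebra :: ('b, ('a, 'b) free_alg) module) = free_scale"
    by (simp_all add: free_algebra_def type_algebra_def)
  have coset: "H_ideal C +>\<^bsub>free_algebra\<^esub> q = (\<lambda>i. i + q) ` H_ideal C" for q
    by (auto simp: a_r_coset_def r_coset_def)
  have "H_ideal C +>\<^bsub>free_algebra\<^esub> free_scale c a = H_ideal C +>\<^bsub>free_algebra\<^esub> free_scale c p"
    if a: "a \<in> H_ideal C +>\<^bsub>free_algebra\<^esub> p" for a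
  proof -
    from a obtain i where i: "i \<in> H_ideal C" "a = i + p" by (auto simp: coset)
    have "free_scale c i \<in> H_ideal C"
      using I.I_l_closed[OF i(1), of "Poly_Mapping.single 0 c"] by (simp add: free_scale_eq)
    moreover have "free_scale c a = free_scale c i + free_scale c p"
      by (simp add: free_scale_eq i(2) distrib_left)
    ultimately have "free_scale c a \<in> H_ideal C +>\<^bsub>free_algebra\<^esub> free_scale c p" by (auto simp: coset)
    from I.a_repr_independence[OF this _ I.a_subgroup] show ?thesis by simp
  qed
  then have "(\<Union>a\<in>H_ideal C +>\<^bsub>free_algebra\<^esub> p. H_ideal C +>\<^bsub>free_algebra\<^esub> free_scale c a)
      = (\<Union>a\<in>H_ideal C +>\<^bsub>free_algebra\<^esub> p. H_ideal C +>\<^bsub>free_algebra\<^esub> free_scale c p)"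
    by (intro SUP_cong refl)
  also have "\<dots> = H_ideal C +>\<^bsub>free_algebra\<^esub> free_scale c p"
  proof (rule UN_constant_eq)
    show "p \<in> H_ideal C +>\<^bsub>free_algebra\<^esub> p" by (rule I.a_rcos_self) simp
  qed simp
  finally show ?thesis
    by (simp add: H_algebra_def quotient_algebra_def ring.defs module.defs)
qed

end

theory Submission
  imports Defs
begin

text \<open>On power series in the commuting \<open>\<partial>\<^sub>a\<close>, commutation with \<open>x\<^sub>b\<close> is the partial derivative \<open>D\<^sub>b\<close> with
  respect to \<open>\<partial>\<^sub>b\<close>. Replacing the matrix \<open>C\<close> by \<open>t C\<close> turns all series into power series in \<open>t\<close> with
  polynomial coefficients, so that no completion is needed for the calculation. Let \<open>w\<^sub>b\<close> be row \<open>b\<close> of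
  \<open>W = (1 - exp(-t C)) / C\<close> and \<open>A(v)\<close> the matrix of \<open>u \<mapsto> [u, v]\<close>, so that \<open>C = A(\<partial>)\<close> and
  \<open>dw\<^sub>b/dt = e\<^sub>b - [w\<^sub>b, \<partial>]\<close>. Both \<open>D\<^sub>b exp(t C) - A(w\<^sub>b) exp(t C)\<close> and the Maurer-Cartan defect
  \<open>D\<^sub>a w\<^sub>b - D\<^sub>b w\<^sub>a - [w\<^sub>a, w\<^sub>b]\<close> vanish at \<open>t = 0\<close> and, by the Jacobi identity, solve homogeneous linear
  differential equations in \<open>t\<close>; hence they are zero. Since \<open>\<psi>(t C) W = t\<close>, multiplying these identities by
  \<open>\<psi>(t C)\<close> and setting \<open>t = 1\<close> gives the commutation relations.\<close>

section \<open>Row vectors and matrices over a ring\<close>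

lemma vector_matrix_mult_diff: "x v* (A - B) = x v* A - x v* (B :: 'r::comm_ring_1 ^ 'n ^ 'm)"
  by (simp add: vector_matrix_mult_def vec_eq_iff algebra_simps sum_subtractf)

lemma matrix_diff_ldistrib: "A ** (B - C) = A ** B - A ** (C :: 'r::ring_1 ^ 'n ^ 'm)"
  by (simp add: matrix_matrix_mult_def vec_eq_iff algebra_simps sum_subtractf)

lemma matrix_diff_rdistrib: "(B - C) ** A = B ** A - C ** (A :: 'r::ring_1 ^ 'n ^ 'm)"
  by (simp add: matrix_matrix_mult_def vec_eq_iff algebra_simps sum_subtractf)

lemma matrix_add_rdistrib: "(B + C) ** A = B ** A + C ** (A :: 'r::ring_1 ^ 'n ^ 'm)"
  by (simp add: matrix_matrix_mult_def vec_eq_iff algebra_simps sum.distrib)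

lemma axis_vector_matrix_mult: "axis i 1 v* A = (A :: 'r::comm_ring_1 ^ 'n ^ 'm) $ i"
proof -
  have "(\<Sum>k\<in>UNIV. axis i 1 $ k * A $ k $ j) = (\<Sum>k\<in>UNIV. if k = i then A $ k $ j else 0)" for j
    by (rule sum.cong) (auto simp: axis_def)
  then show ?thesis by (simp add: vector_matrix_mult_def vec_eq_iff)
qed

text \<open>Allows identities between matrices \<open>right_mult_matrix c v\<close> to be checked as
  bracket identities on row vectors.\<close>

lemma matrix_eq_rowI:
  assumes "\<And>x. x v* A = x v* (B :: 'r::comm_ring_1 ^ 'n ^ 'm)"
  shows "A = B"
  using assms[of "axis _ 1"] by (simp add: axis_vector_matrix_mult vec_eq_iff)

lemma row_matrix_mult: "(A ** B) $ i = A $ i v* (B :: 'r::comm_ring_1 ^ 'n ^ 'm)"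
  by (simp add: matrix_matrix_mult_def vector_matrix_mult_def vec_eq_iff)

lemma vector_matrix_mult_sum: "x v* M = (\<Sum>i\<in>UNIV. x $ i *s (M :: 'r::comm_ring_1 ^ 'n ^ 'm) $ i)"
  by (simp add: vector_matrix_mult_def vec_eq_iff)

section \<open>Brackets given by structure constants\<close>

text \<open>The entries lie in an arbitrary commutative ring, so that vectors of power series can be
  bracketed as well.\<close>

definition lie_brk :: "('n \<Rightarrow> 'n \<Rightarrow> 'n \<Rightarrow> 'r::comm_ring_1) \<Rightarrow> 'r ^ 'n::finite \<Rightarrow> 'r ^ 'n \<Rightarrow> 'r ^ 'n" where
  "lie_brk c u v = (\<chi> l. \<Sum>i\<in>UNIV. \<Sum>j\<in>UNIV. u $ i * v $ j * c i j l)"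

text \<open>This is \<open>A(v)\<close> of the overview. Its index order is that of the structure
  matrix, which is obtained when \<open>v\<close> is the vector of the
  \<open>\<partial>\<^sub>a\<close>.\<close>

definition right_mult_matrix :: "('n \<Rightarrow> 'n \<Rightarrow> 'n \<Rightarrow> 'r::comm_ring_1) \<Rightarrow> 'r ^ 'n::finite \<Rightarrow> 'r ^ 'n ^ 'n" where
  "right_mult_matrix c v = (\<chi> i l. \<Sum>j\<in>UNIV. v $ j * c i j l)"

lemma lie_brk_add_left: "lie_brk c (u + v) w = lie_brk c u w + lie_brk c v w"
  by (simp add: lie_brk_def vec_eq_iff algebra_simps sum.distrib)

lemma lie_brk_add_right: "lie_brk c w (u + v) = lie_brk c w u + lie_brk c w v"
  by (simp add: lie_brk_def vec_eq_iff algebra_simps sum.distrib)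

lemma lie_brk_minus_left: "lie_brk c (- u) w = - lie_brk c u w"
  by (simp add: lie_brk_def vec_eq_iff sum_negf)

lemma lie_brk_minus_right: "lie_brk c w (- u) = - lie_brk c w u"
  by (simp add: lie_brk_def vec_eq_iff sum_negf)

lemma lie_brk_diff_left: "lie_brk c (u - v) w = lie_brk c u w - lie_brk c v w"
  using lie_brk_add_left[of c u "- v" w] by (simp add: lie_brk_minus_left)

lemma lie_brk_diff_right: "lie_brk c w (u - v) = lie_brk c w u - lie_brk c w v"
  using lie_brk_add_right[of c w u "- v"] by (simp add: lie_brk_minus_right)

lemmas lie_brk_linear = lie_brk_add_left lie_brk_add_right lie_brk_minus_left lie_brk_minus_right
  lie_brk_diff_left lie_brk_diff_right

lemma right_mult_matrix_diff:
  "right_mult_matrix c (u - v) = right_mult_matrix c u - right_mult_matrix c v"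
  by (simp add: right_mult_matrix_def vec_eq_iff algebra_simps sum_subtractf)

lemma vector_right_mult_matrix: "u v* right_mult_matrix c v = lie_brk c u v"
  by (simp add: vector_matrix_mult_def right_mult_matrix_def lie_brk_def sum_distrib_left mult.assoc)

lemma lie_brk_scale_left: "lie_brk c (x *s u) v = x *s lie_brk c u v"
  by (simp add: lie_brk_def vec_eq_iff sum_distrib_left mult.assoc)

lemma lie_brk_scale_right: "lie_brk c u (x *s v) = x *s lie_brk c u v"
  by (simp add: lie_brk_def vec_eq_iff sum_distrib_left mult_ac)

lemma lie_brk_sum_left: "lie_brk c (sum f S) v = (\<Sum>s\<in>S. lie_brk c (f s) v)"
proof -
  have "lie_brk c 0 v = 0" by (simp add: lie_brk_def vec_eq_iff)
  then show ?thesis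
    by (induction S rule: infinite_finite_induct) (simp_all add: lie_brk_add_left)
qed

lemma lie_brk_sum_right: "lie_brk c v (sum f S) = (\<Sum>s\<in>S. lie_brk c v (f s))"
proof -
  have "lie_brk c v 0 = 0" by (simp add: lie_brk_def vec_eq_iff)
  then show ?thesis
    by (induction S rule: infinite_finite_induct) (simp_all add: lie_brk_add_right)
qed

lemma lie_brk_axis: "lie_brk c (axis i 1) (axis j 1) $ l = c i j l"
proof -
  have "(\<Sum>b\<in>UNIV. axis i 1 $ a * axis j 1 $ b * c a b l) =
      (\<Sum>b\<in>UNIV. if b = j then if a = i then c i j l else 0 else 0)" for a
    by (rule sum.cong) (auto simp: axis_def)
  then have "lie_brk c (axis i 1) (axis j 1) $ l = (\<Sum>a\<in>UNIV. if a = i then c i j l else 0)"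
    by (simp add: lie_brk_def)
  then show ?thesis by simp
qed

lemma lie_brk_vector_matrix_mult:
  "lie_brk c (x v* M) (y v* N) =
    (\<Sum>i\<in>UNIV. \<Sum>j\<in>UNIV. (x $ i * y $ j) *s lie_brk c (M $ i) (N $ j))"
proof -
  have "lie_brk c (x v* M) (y v* N) =
      (\<Sum>j\<in>UNIV. \<Sum>i\<in>UNIV. y $ j *s (x $ i *s lie_brk c (M $ i) (N $ j)))"
    by (simp add: vector_matrix_mult_sum[of x] vector_matrix_mult_sum[of y] lie_brk_sum_left
      lie_brk_sum_right lie_brk_scale_left lie_brk_scale_right vec_eq_iff sum_distrib_left mult.assoc)
  also have "\<dots> = (\<Sum>i\<in>UNIV. \<Sum>j\<in>UNIV. y $ j *s (x $ i *s lie_brk c (M $ i) (N $ j)))"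
    by (rule sum.swap)
  finally show ?thesis by (simp add: vector_smult_assoc mult.commute)
qed

lemma right_mult_matrix_axis: "right_mult_matrix c (axis i 1) $ a $ b = c a i b"
proof -
  have "right_mult_matrix c (axis i 1) $ a = axis a 1 v* right_mult_matrix c (axis i 1)"
    by (simp add: axis_vector_matrix_mult)
  then show ?thesis by (simp add: vector_right_mult_matrix lie_brk_axis)
qed

locale structure_constants =
  fixes c :: "'n::finite \<Rightarrow> 'n \<Rightarrow> 'n \<Rightarrow> 'r::comm_ring_1"
  assumes antisym: "c i j l = - c j i l"
    and jacobi: "(\<Sum>k\<in>UNIV. c i j k * c k l m) + (\<Sum>k\<in>UNIV. c j l k * c k i m) + (\<Sum>k\<in>UNIV. c l i k * c k j m) = 0"
begin

lemma lie_brk_antisym: "lie_brk c u v = - lie_brk c v u"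
proof -
  have "(\<Sum>i\<in>UNIV. \<Sum>j\<in>UNIV. u $ i * v $ j * c i j l) = (\<Sum>i\<in>UNIV. \<Sum>j\<in>UNIV. - (v $ i * u $ j * c i j l))" for l
    by (rule trans[OF sum.swap], intro sum.cong refl, subst antisym) (simp add: mult.commute)
  then show ?thesis by (simp add: lie_brk_def vec_eq_iff sum_negf)
qed

text \<open>Isolates the contraction of structure constants as the coefficient of
  \<open>u $ i * v $ j * w $ l\<close>, so that the Jacobi identity applies termwise; the swaps only
  move the sum over \<open>k\<close> inside.\<close>

lemma lie_brk_lie_brk:
  "lie_brk c (lie_brk c u v) w $ m =
    (\<Sum>i\<in>UNIV. \<Sum>j\<in>UNIV. \<Sum>l\<in>UNIV. u $ i * v $ j * w $ l * (\<Sum>k\<in>UNIV. c i j k * c k l m))"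
proof -
  have "lie_brk c (lie_brk c u v) w $ m =
      (\<Sum>k\<in>UNIV. \<Sum>l\<in>UNIV. \<Sum>i\<in>UNIV. \<Sum>j\<in>UNIV. u $ i * v $ j * w $ l * (c i j k * c k l m))"
    unfolding lie_brk_def vec_lambda_beta sum_distrib_right sum_distrib_left
    by (intro sum.cong refl) (simp only: mult_ac)
  also have "\<dots> = (\<Sum>l\<in>UNIV. \<Sum>k\<in>UNIV. \<Sum>i\<in>UNIV. \<Sum>j\<in>UNIV. u $ i * v $ j * w $ l * (c i j k * c k l m))"
    by (rule sum.swap)
  also have "\<dots> = (\<Sum>l\<in>UNIV. \<Sum>i\<in>UNIV. \<Sum>k\<in>UNIV. \<Sum>j\<in>UNIV. u $ i * v $ j * w $ l * (c i j k * c k l m))"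
    by (rule sum.cong[OF refl], rule sum.swap)
  also have "\<dots> = (\<Sum>i\<in>UNIV. \<Sum>l\<in>UNIV. \<Sum>k\<in>UNIV. \<Sum>j\<in>UNIV. u $ i * v $ j * w $ l * (c i j k * c k l m))"
    by (rule sum.swap)
  also have "\<dots> = (\<Sum>i\<in>UNIV. \<Sum>l\<in>UNIV. \<Sum>j\<in>UNIV. \<Sum>k\<in>UNIV. u $ i * v $ j * w $ l * (c i j k * c k l m))"
    by (rule sum.cong[OF refl], rule sum.cong[OF refl], rule sum.swap)
  also have "\<dots> = (\<Sum>i\<in>UNIV. \<Sum>j\<in>UNIV. \<Sum>l\<in>UNIV. \<Sum>k\<in>UNIV. u $ i * v $ j * w $ l * (c i j k * c k l m))"
    by (rule sum.cong[OF refl], rule sum.swap)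
  finally show ?thesis by (simp add: sum_distrib_left)
qed

text \<open>After relabelling summation indices all three terms run over the same monomials
  \<open>u $ i * v $ j * w $ l\<close>, whose coefficients cancel by \<open>jacobi\<close>.\<close>

lemma lie_brk_jacobi: "lie_brk c (lie_brk c u v) w - lie_brk c (lie_brk c u w) v = lie_brk c u (lie_brk c v w)"
proof -
  let ?J = "\<lambda>i j l m. \<Sum>k\<in>UNIV. c i j k * c k l m"
  have "lie_brk c (lie_brk c u w) v $ m
      = (\<Sum>i\<in>UNIV. \<Sum>j\<in>UNIV. \<Sum>l\<in>UNIV. u $ i * v $ j * w $ l * ?J i l j m)" for m
    unfolding lie_brk_lie_brk
    by (rule sum.cong[OF refl], rule trans[OF sum.swap], intro sum.cong refl) (simp only: mult_ac)
  moreover have "lie_brk c (lie_brk c v w) u $ m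
      = (\<Sum>i\<in>UNIV. \<Sum>j\<in>UNIV. \<Sum>l\<in>UNIV. u $ i * v $ j * w $ l * ?J j l i m)" for m
  proof -
    have "lie_brk c (lie_brk c v w) u $ m
        = (\<Sum>j\<in>UNIV. \<Sum>i\<in>UNIV. \<Sum>l\<in>UNIV. u $ i * v $ j * w $ l * ?J j l i m)"
      unfolding lie_brk_lie_brk
      by (rule sum.cong[OF refl], rule trans[OF sum.swap], intro sum.cong refl) (simp only: mult_ac)
    also have "\<dots> = (\<Sum>i\<in>UNIV. \<Sum>j\<in>UNIV. \<Sum>l\<in>UNIV. u $ i * v $ j * w $ l * ?J j l i m)"
      by (rule sum.swap)
    finally show ?thesis .
  qed
  moreover have "?J i j l m - ?J i l j m + ?J j l i m = 0" for i j l m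
  proof -
    have "?J i l j m = - ?J l i j m"
      by (simp add: antisym[of i l] sum_negf)
    then show ?thesis using jacobi[of i j l m] by (simp add: algebra_simps)
  qed
  then have "u $ i * v $ j * w $ l * ?J i j l m - u $ i * v $ j * w $ l * ?J i l j m
      + u $ i * v $ j * w $ l * ?J j l i m = 0" for i j l m
    by (metis (no_types, lifting) distrib_left mult_zero_right right_diff_distrib)
  ultimately have "lie_brk c (lie_brk c u v) w $ m - lie_brk c (lie_brk c u w) v $ m
      + lie_brk c (lie_brk c v w) u $ m = 0" for m
    by (simp only: lie_brk_lie_brk[of u v w] sum_subtractf[symmetric] sum.distrib[symmetric] sum.neutral_const)
  then have "lie_brk c (lie_brk c u v) w - lie_brk c (lie_brk c u w) v + lie_brk c (lie_brk c v w) u = 0"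
    by (simp add: vec_eq_iff)
  then show ?thesis
    unfolding lie_brk_antisym[of u "lie_brk c v w"] by (simp only: eq_neg_iff_add_eq_0)
qed

text \<open>The Jacobi identity, read as: \<open>A\<close> is a representation. There is no sign
  because matrices act on rows from the right, so products compose from left to right.\<close>

lemma right_mult_matrix_lie_brk:
  "right_mult_matrix c (lie_brk c v w) =
    right_mult_matrix c v ** right_mult_matrix c w - right_mult_matrix c w ** right_mult_matrix c v"
  by (rule matrix_eq_rowI)
    (simp only: vector_matrix_mult_diff vector_matrix_mul_assoc[symmetric] vector_right_mult_matrix lie_brk_jacobi)

end

section \<open>Derivations and power series in one matrix\<close>

text \<open>Covers the derivative in the series variable \<open>t\<close>, the partial derivatives
  of polynomials, and the coefficientwise extension of the latter to power series.\<close>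

locale derivation =
  fixes D :: "'r::comm_ring_1 \<Rightarrow> 'r"
  assumes add: "D (x + y) = D x + D y"
    and mult: "D (x * y) = D x * y + x * D y"
begin

lemma zero [simp]: "D 0 = 0"
  using add[of 0 0] by simp

lemma one [simp]: "D 1 = 0"
  using mult[of 1 1] by simp

lemma uminus: "D (- x) = - D x"
  using add[of x "- x"] by (simp add: add_eq_0_iff)

lemma diff: "D (x - y) = D x - D y"
  using add[of x "- y"] by (simp add: uminus)

lemma sum: "D (sum f S) = (\<Sum>s\<in>S. D (f s))"
  by (induction S rule: infinite_finite_induct) (auto simp: add)

lemma of_nat [simp]: "D (of_nat n) = 0"
  by (induction n) (auto simp: add)

abbreviation "Dv v \<equiv> (\<chi> i. D (v $ i))"
abbreviation "Dm M \<equiv> (\<chi> i j. D (M $ i $ j))"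

lemma matrix_mult: "Dm (A ** B) = Dm A ** B + A ** Dm (B :: 'r ^ 'n ^ 'm)"
  by (simp add: matrix_matrix_mult_def vec_eq_iff sum mult sum.distrib)

lemma lie_brk:
  assumes "\<And>i j l. D (c i j l) = 0"
  shows "Dv (lie_brk c u v) = lie_brk c (Dv u) v + lie_brk c u (Dv v)"
  by (simp add: lie_brk_def vec_eq_iff sum mult sum.distrib assms algebra_simps)

lemma right_mult_matrix:
  assumes "\<And>i j l. D (c i j l) = 0"
  shows "Dm (right_mult_matrix c v) = right_mult_matrix c (Dv v)"
  by (simp add: right_mult_matrix_def vec_eq_iff sum mult assms)

end

interpretation fps_deriv: derivation "fps_deriv :: 'r::comm_ring_1 fps \<Rightarrow> 'r fps"
  by standard (simp_all add: algebra_simps)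

lemma matrix_pow_add: "matrix_pow M (a + b) = matrix_pow M a ** matrix_pow M b"
  by (induction a) (simp_all add: matrix_mul_assoc)

section \<open>Power series evaluated at a scaled matrix\<close>

text \<open>This is \<open>F(t M)\<close>: the power of \<open>t\<close> records the power of
  \<open>M\<close>, so that no coefficient involves an infinite sum. The map \<open>\<iota>\<close>
  embeds the scalars in the ring of entries.\<close>

definition matrix_series ::
    "('k \<Rightarrow> 'r) \<Rightarrow> 'k fps \<Rightarrow> 'r::comm_ring_1 ^ 'm ^ 'm \<Rightarrow> 'r fps ^ 'm ^ 'm::finite" where
  "matrix_series \<iota> F M = (\<chi> i j. Abs_fps (\<lambda>k. \<iota> (fps_nth F k) * matrix_pow M k $ i $ j))"

lemma matrix_series_nth: "fps_nth (matrix_series \<iota> F M $ i $ j) n = \<iota> (fps_nth F n) * matrix_pow M n $ i $ j"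
  by (simp add: matrix_series_def)

locale comm_ring_hom_fun =
  fixes \<iota> :: "'k::comm_ring_1 \<Rightarrow> 'r::comm_ring_1"
  assumes hom_add: "\<iota> (x + y) = \<iota> x + \<iota> y"
    and hom_mult: "\<iota> (x * y) = \<iota> x * \<iota> y"
    and hom_one: "\<iota> 1 = 1"
begin

lemma hom_zero: "\<iota> 0 = 0"
  using hom_add[of 0 0] by simp

lemma hom_uminus: "\<iota> (- x) = - \<iota> x"
  using hom_add[of x "- x"] by (simp add: hom_zero add_eq_0_iff)

lemma hom_sum: "\<iota> (sum f S) = (\<Sum>s\<in>S. \<iota> (f s))"
  by (induction S rule: infinite_finite_induct) (auto simp: hom_zero hom_add)

lemma hom_of_nat: "\<iota> (of_nat n) = of_nat n"
  by (induction n) (auto simp: hom_zero hom_add hom_one)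

lemma matrix_series_diff: "matrix_series \<iota> (F - G) M = matrix_series \<iota> F M - matrix_series \<iota> G M"
proof -
  have "\<iota> (x - y) = \<iota> x - \<iota> y" for x y
    using hom_add[of x "- y"] by (simp add: hom_uminus)
  then show ?thesis
    by (simp add: matrix_series_def vec_eq_iff fps_eq_iff left_diff_distrib)
qed

lemma matrix_series_one: "matrix_series \<iota> 1 M = mat 1"
  by (auto simp: matrix_series_def vec_eq_iff fps_eq_iff mat_def hom_zero hom_one)

lemma matrix_series_X: "matrix_series \<iota> fps_X M = (\<chi> i j. fps_X * fps_const (M $ i $ j))"
  by (auto simp: matrix_series_def vec_eq_iff fps_eq_iff fps_X_def hom_zero hom_one)

lemma matrix_series_mult: "matrix_series \<iota> (F * G) M = matrix_series \<iota> F M ** matrix_series \<iota> G M"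
proof -
  have "\<iota> (fps_nth (F * G) n) * matrix_pow M n $ i $ j =
      (\<Sum>l\<in>UNIV. \<Sum>m\<le>n. \<iota> (fps_nth F m) * matrix_pow M m $ i $ l *
        (\<iota> (fps_nth G (n - m)) * matrix_pow M (n - m) $ l $ j))" for n i j
  proof -
    have "\<iota> (fps_nth (F * G) n) * matrix_pow M n $ i $ j =
        (\<Sum>m\<le>n. \<iota> (fps_nth F m) * \<iota> (fps_nth G (n - m)) * matrix_pow M n $ i $ j)"
      by (simp add: fps_mult_nth hom_sum hom_mult sum_distrib_right atLeast0AtMost)
    also have "\<dots> = (\<Sum>m\<le>n. \<iota> (fps_nth F m) * \<iota> (fps_nth G (n - m)) *
        (matrix_pow M m ** matrix_pow M (n - m)) $ i $ j)"
      by (intro sum.cong refl) (simp flip: matrix_pow_add)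
    also have "\<dots> = (\<Sum>m\<le>n. \<Sum>l\<in>UNIV. \<iota> (fps_nth F m) * matrix_pow M m $ i $ l *
        (\<iota> (fps_nth G (n - m)) * matrix_pow M (n - m) $ l $ j))"
      by (simp add: matrix_matrix_mult_def sum_distrib_left mult_ac)
    finally show ?thesis by (simp only: sum.swap[of _ UNIV])
  qed
  then have "fps_nth (matrix_series \<iota> (F * G) M $ i $ j) n =
      (\<Sum>l\<in>UNIV. fps_nth (matrix_series \<iota> F M $ i $ l * matrix_series \<iota> G M $ l $ j) n)" for i j n
    by (simp only: matrix_series_nth fps_mult_nth[of "_ $ _ $ _"] atLeast0AtMost)
  then show ?thesis
    by (intro vec_eq_iff[THEN iffD2] allI fps_ext) (simp add: matrix_matrix_mult_def fps_sum_nth)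
qed

text \<open>The chain rule for \<open>F(t M)\<close>: termwise, one factor \<open>M\<close> splits
  off on the left.\<close>

lemma matrix_series_deriv:
  "(\<chi> i j. fps_deriv (matrix_series \<iota> F M $ i $ j)) =
    (\<chi> i j. fps_const (M $ i $ j)) ** matrix_series \<iota> (fps_deriv F) M"
proof -
  have "of_nat (n + 1) * (\<iota> (fps_nth F (n + 1)) * (\<Sum>l\<in>UNIV. M $ i $ l * matrix_pow M n $ l $ j)) =
      (\<Sum>l\<in>UNIV. M $ i $ l * (\<iota> (of_nat (n + 1) * fps_nth F (n + 1)) * matrix_pow M n $ l $ j))" for i j n
    unfolding hom_mult hom_of_nat sum_distrib_left by (intro sum.cong refl) (simp only: mult_ac)
  then show ?thesis
    by (simp add: matrix_series_def vec_eq_iff fps_eq_iff matrix_matrix_mult_def fps_sum_nth)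
qed

end

section \<open>Polynomial symbols and the generic matrix\<close>

text \<open>Reduces the general Leibniz rule \<open>mderiv_mult\<close> to the product rule for
  \<open>pdiff\<close>.\<close>

lemma splits_single: "splits (Poly_Mapping.single i (1::nat)) = {(Poly_Mapping.single i 1, 0), (0, Poly_Mapping.single i 1)}"
proof -
  have "(a = Poly_Mapping.single i 1 \<and> b = 0) \<or> (a = 0 \<and> b = Poly_Mapping.single i 1)"
    if "a + b = Poly_Mapping.single i 1" for a b :: "'a mindex"
  proof -
    have l: "Poly_Mapping.lookup a k + Poly_Mapping.lookup b k = (if k = i then 1 else 0)" for k
      using arg_cong[OF that, of "\<lambda>c. Poly_Mapping.lookup c k"]
      by (auto simp: lookup_add lookup_single when_def)
    then have "Poly_Mapping.lookup a k = 0 \<and> Poly_Mapping.lookup b k = 0" if "k \<noteq> i" for k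
      using that by (metis add_is_0)
    moreover have "Poly_Mapping.lookup a i = 0 \<and> Poly_Mapping.lookup b i = 1 \<or>
        Poly_Mapping.lookup a i = 1 \<and> Poly_Mapping.lookup b i = 0"
      using l[of i] by (auto simp: add_is_1)
    ultimately have "(\<forall>k. Poly_Mapping.lookup a k = (if k = i then 1 else 0) \<and> Poly_Mapping.lookup b k = 0) \<or>
        (\<forall>k. Poly_Mapping.lookup a k = 0 \<and> Poly_Mapping.lookup b k = (if k = i then 1 else 0))"
      by metis
    moreover have "x = Poly_Mapping.single i 1 \<longleftrightarrow> (\<forall>k. Poly_Mapping.lookup x k = (if k = i then 1 else 0))"
      "x = 0 \<longleftrightarrow> (\<forall>k. Poly_Mapping.lookup x k = 0)" for x :: "'a mindex"
      by (auto simp: poly_mapping_eq_iff fun_eq_iff lookup_single when_def)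
    ultimately show ?thesis by auto
  qed
  then show ?thesis by (auto simp: splits_def)
qed

definition pdiff :: "'n::finite \<Rightarrow> ('n, 'k::field_char_0) mpolynomial \<Rightarrow> ('n, 'k) mpolynomial" where
  "pdiff i = mderiv (Poly_Mapping.single i 1)"

text \<open>Here a polynomial serves as a symbol: \<open>var i\<close> stands for
  \<open>\<partial>\<^sub>i\<close>, although the type is also that of the polynomials in
  \<open>x\<close> on which the operators act.\<close>

definition var :: "'n::finite \<Rightarrow> ('n, 'k::field_char_0) mpolynomial" where
  "var i = Poly_Mapping.single (Poly_Mapping.single i 1) 1"

lemma single_1_neq_0: "Poly_Mapping.single i (1::nat) \<noteq> 0"
  by (metis lookup_single_eq lookup_zero zero_neq_one)

lemma pdiff_mult: "pdiff i (p * q) = pdiff i p * q + p * pdiff i q"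
proof -
  have "mbinom (a :: 'a mindex) a = 1" "mbinom a 0 = 1" for a
    by (simp_all add: mbinom_def)
  then show ?thesis unfolding pdiff_def mderiv_mult splits_single using single_1_neq_0[of i] by simp
qed

interpretation pdiff: derivation "pdiff i"
  by standard (simp_all add: pdiff_mult, simp add: pdiff_def mderiv_add)

lemma pdiff_const: "pdiff i (Poly_Mapping.single 0 x) = 0"
proof (rule poly_mapping_eqI)
  fix a :: "'a mindex"
  have "a + Poly_Mapping.single i 1 \<noteq> 0"
    using single_1_neq_0[of i] by (metis add_eq_0_iff_both_eq_0 lookup_add lookup_zero poly_mapping_eqI)
  then show "Poly_Mapping.lookup (pdiff i (Poly_Mapping.single 0 x)) a = Poly_Mapping.lookup 0 a"
    by (simp add: pdiff_def lookup_mderiv lookup_single when_def eq_commute[of 0])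
qed

lemma pdiff_var: "pdiff i (var j) = (if i = j then 1 else 0)"
proof (cases "i = j")
  case True
  have "mfact (Poly_Mapping.single i 1 :: 'a mindex) = (1 :: 'b)"
    by (auto simp: mfact_def lookup_single when_def intro!: prod.neutral)
  then show ?thesis using True by (simp add: pdiff_def var_def mderiv_single mbinom_def)
next
  case False
  then have "mbinom (Poly_Mapping.single j 1) (Poly_Mapping.single i 1) = 0"
    unfolding mbinom_def by (intro prod_zero) (auto simp: lookup_single when_def)
  then show ?thesis using False by (simp add: pdiff_def var_def mderiv_single)
qed

lemma fps_const_sum: "fps_const (sum f S) = (\<Sum>s\<in>S. fps_const (f s))"
  by (simp add: fps_eq_iff fps_sum_nth)

definition fps_map :: "('a \<Rightarrow> 'b) \<Rightarrow> 'a fps \<Rightarrow> 'b fps" where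
  "fps_map f F = Abs_fps (\<lambda>k. f (fps_nth F k))"

lemma fps_nth_fps_map [simp]: "fps_nth (fps_map f F) k = f (fps_nth F k)"
  by (simp add: fps_map_def)

context derivation
begin

lemma derivation_fps_map: "derivation (fps_map D)"
  by standard (simp_all add: fps_eq_iff fps_mult_nth add mult sum sum.distrib)

lemma fps_map_const: "fps_map D (fps_const a) = fps_const (D a)"
  by (simp add: fps_eq_iff)

lemma fps_map_X_mult: "fps_map D (fps_X * F) = fps_X * fps_map D F"
  by (simp add: fps_eq_iff)

lemma fps_map_fps_deriv: "fps_map D (fps_deriv F) = fps_deriv (fps_map D F)"
  by (simp add: fps_eq_iff mult add)

end

interpretation pconst: comm_ring_hom_fun "Poly_Mapping.single 0 :: 'k::field_char_0 \<Rightarrow> ('n::finite, 'k) mpolynomial"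
  by standard (simp_all add: single_add mult_single)

section \<open>Uniqueness for linear differential equations, and the scalar series\<close>

text \<open>The equation expresses \<open>Suc m\<close> times the coefficient of index
  \<open>Suc m\<close> through lower coefficients, which vanish by induction. The assumption
  \<open>torsion\<close> replaces division, since the coefficient ring is not a field.\<close>

lemma fps_linear_ode_unique:
  fixes G :: "'i::finite \<Rightarrow> 'r::{comm_ring_1, ring_char_0} fps"
  assumes torsion: "\<And>n x. of_nat (Suc n) * x = (0::'r) \<Longrightarrow> x = 0"
    and deriv: "\<And>i. fps_deriv (G i) = (\<Sum>j\<in>UNIV. Q i j * G j)"
    and init: "\<And>i. fps_nth (G i) 0 = 0"
  shows "G i = 0"
proof -
  have "\<forall>i. fps_nth (G i) n = 0" for n
  proof (induction n rule: less_induct)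
    case (less n)
    show ?case
    proof (cases n)
      case (Suc m)
      have "of_nat (Suc m) * fps_nth (G i) (Suc m) = fps_nth (fps_deriv (G i)) m" for i by simp
      also have "\<dots> i = 0" for i
        unfolding deriv fps_sum_nth fps_mult_nth using less Suc by (simp add: sum.neutral)
      finally show ?thesis using torsion Suc by blast
    qed (simp add: init)
  qed
  then show ?thesis by (simp add: fps_eq_iff)
qed

lemma mpolynomial_of_nat_mult_eq_0:
  fixes x :: "('n::finite, 'k::field_char_0) mpolynomial"
  assumes "of_nat (Suc n) * x = 0"
  shows "x = 0"
proof -
  have "Poly_Mapping.single 0 (1 / of_nat (Suc n)) * of_nat (Suc n) = (1 :: ('n, 'k) mpolynomial)"
    by (simp del: of_nat_Suc add: mult_single flip: single_of_nat)
  then have "x = Poly_Mapping.single 0 (1 / of_nat (Suc n)) * (of_nat (Suc n) * x)"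
    by (simp only: mult.assoc[symmetric]) simp
  then show ?thesis using assms by simp
qed

text \<open>The reciprocal \<open>(1 - exp(-t)) / t\<close> of \<open>psi\<close>; the shift divides
  by \<open>t\<close> exactly, as the constant coefficient of \<open>1 - exp(-t)\<close> is
  zero.\<close>

definition psi_inv :: "'k::field_char_0 fps" where
  "psi_inv = fps_shift 1 (1 - fps_exp (-1))"

lemma X_mult_psi_inv: "fps_X * psi_inv = 1 - fps_exp (-1 :: 'k::field_char_0)"
  unfolding psi_inv_def by (auto simp: fps_eq_iff)

lemma psi_mult_psi_inv: "psi * psi_inv = (1 :: 'k::field_char_0 fps)"
proof -
  have "fps_X * (psi * psi_inv) = (fps_X * 1 :: 'k fps)"
    by (metis X_mult_psi_inv mult.left_commute mult.right_neutral psi_times)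
  then show ?thesis by simp
qed

text \<open>Both sides are \<open>exp(-t)\<close>, the left one as the derivative of
  \<open>t psi_inv\<close>. The factor \<open>fps_X\<close> stands on the right to match
  \<open>W ** right_mult_matrix c p\<close> in \<open>W_deriv\<close>.\<close>

lemma psi_inv_deriv:
  "psi_inv + fps_X * fps_deriv psi_inv = 1 - psi_inv * (fps_X :: 'k::field_char_0 fps)"
proof -
  have "psi_inv + fps_X * fps_deriv psi_inv = fps_deriv (fps_X * psi_inv :: 'k fps)"
    by simp
  also have "\<dots> = fps_exp (-1)" unfolding X_mult_psi_inv by (simp add: fps_eq_iff)
  finally show ?thesis using X_mult_psi_inv[where 'k = 'k] by (simp add: mult.commute[of psi_inv])
qed

section \<open>The exponential and the Maurer-Cartan form of the scaled structure matrix\<close>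

locale lie_symbol_calculus = structure_constants C
  for C :: "'n::finite \<Rightarrow> 'n \<Rightarrow> 'n \<Rightarrow> 'k::field_char_0"
begin

definition c :: "'n \<Rightarrow> 'n \<Rightarrow> 'n \<Rightarrow> ('n, 'k) mpolynomial fps" where
  "c i j l = fps_const (Poly_Mapping.single 0 (C i j l))"

definition p :: "('n, 'k) mpolynomial fps ^ 'n" where
  "p = (\<chi> a. fps_const (var a))"

definition symbol :: "('n, 'k) mpolynomial ^ 'n ^ 'n" where
  "symbol = (\<chi> i j. \<Sum>a\<in>UNIV. Poly_Mapping.single 0 (C i a j) * var a)"

abbreviation series :: "'k fps \<Rightarrow> ('n, 'k) mpolynomial fps ^ 'n ^ 'n" where
  "series F \<equiv> matrix_series (Poly_Mapping.single 0) F symbol"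

abbreviation pd :: "'n \<Rightarrow> ('n, 'k) mpolynomial fps \<Rightarrow> ('n, 'k) mpolynomial fps" where
  "pd b \<equiv> fps_map (pdiff b)"

text \<open>This is \<open>(1 - exp(-t C)) / C\<close>, the Maurer-Cartan form in exponential coordinates scaled by \<open>t\<close>.\<close>

definition W :: "('n, 'k) mpolynomial fps ^ 'n ^ 'n" where
  "W = (\<chi> i j. fps_X * series psi_inv $ i $ j)"

abbreviation T :: "('n, 'k) mpolynomial fps ^ 'n ^ 'n" where "T \<equiv> series (fps_exp 1)"
abbreviation Tinv :: "('n, 'k) mpolynomial fps ^ 'n ^ 'n" where "Tinv \<equiv> series (fps_exp (- 1))"
abbreviation Psi :: "('n, 'k) mpolynomial fps ^ 'n ^ 'n" where "Psi \<equiv> series psi"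
abbreviation Phi :: "('n, 'k) mpolynomial fps ^ 'n ^ 'n" where "Phi \<equiv> series psi_inv"

sublocale symbols: structure_constants c
proof
  fix i j l m
  show "c i j l = - c j i l"
    unfolding c_def by (subst antisym) (simp add: pconst.hom_uminus)
  have *: "(\<Sum>k\<in>UNIV. c i j k * c k l m) = fps_const (Poly_Mapping.single 0 (\<Sum>k\<in>UNIV. C i j k * C k l m))" for i j l
    by (simp add: c_def fps_const_sum pconst.hom_sum mult_single)
  show "(\<Sum>k\<in>UNIV. c i j k * c k l m) + (\<Sum>k\<in>UNIV. c j l k * c k i m) + (\<Sum>k\<in>UNIV. c l i k * c k j m) = 0"
    unfolding * using jacobi[of i j l m] by (simp add: single_add[symmetric])
qed

sublocale pd: derivation "pd b" for b
  by (rule pdiff.derivation_fps_map)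

lemma pd_c: "pd b (c i j l) = 0"
  by (simp add: c_def pdiff.fps_map_const pdiff_const)

lemma pd_p: "pd.Dv b p = axis b 1"
  by (auto simp: p_def pdiff.fps_map_const pdiff_var vec_eq_iff axis_def)

lemma fps_deriv_c: "fps_deriv (c i j l) = 0"
  by (simp add: c_def)

lemma right_mult_matrix_p: "right_mult_matrix c p = (\<chi> i j. fps_const (symbol $ i $ j))"
  by (simp add: right_mult_matrix_def c_def p_def symbol_def vec_eq_iff fps_const_sum mult.commute)

text \<open>This is \<open>psi_inv_deriv\<close> at the matrix \<open>t C\<close>: the factor
  \<open>C\<close> from the chain rule and the factor \<open>fps_X\<close> together form
  \<open>series fps_X\<close>.\<close>

lemma W_deriv: "fps_deriv.Dm W = mat 1 - W ** right_mult_matrix c p"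
proof -
  have X: "matrix_series (Poly_Mapping.single 0) fps_X symbol = (\<chi> i j. fps_X * right_mult_matrix c p $ i $ j)"
    by (simp add: pconst.matrix_series_X right_mult_matrix_p)
  have "fps_deriv.Dm W = Phi + (\<chi> i j. fps_X * fps_deriv.Dm Phi $ i $ j)"
    by (simp add: W_def vec_eq_iff)
  also have "fps_deriv.Dm Phi = right_mult_matrix c p ** series (fps_deriv psi_inv)"
    by (simp add: pconst.matrix_series_deriv right_mult_matrix_p)
  also have "(\<chi> i j. fps_X * (right_mult_matrix c p ** series (fps_deriv psi_inv)) $ i $ j)
      = series (fps_X * fps_deriv psi_inv)"
    by (simp add: pconst.matrix_series_mult X matrix_matrix_mult_def vec_eq_iff sum_distrib_left mult.assoc)
  also have "Phi + \<dots> = series (psi_inv + fps_X * fps_deriv psi_inv)"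
    using pconst.matrix_series_diff[of "psi_inv + fps_X * fps_deriv psi_inv" psi_inv symbol]
    by (simp add: algebra_simps)
  also have "\<dots> = mat 1 - Phi ** series fps_X"
    by (simp add: psi_inv_deriv pconst.matrix_series_diff pconst.matrix_series_one pconst.matrix_series_mult)
  also have "Phi ** series fps_X = W ** right_mult_matrix c p"
    by (simp add: X W_def matrix_matrix_mult_def vec_eq_iff mult_ac)
  finally show ?thesis .
qed

lemma W_row_deriv: "fps_deriv.Dv (W $ b) = axis b 1 - lie_brk c (W $ b) p"
proof -
  have "fps_deriv.Dv (W $ b) = fps_deriv.Dm W $ b" by (simp add: vec_eq_iff)
  then show ?thesis
    by (simp add: W_deriv row_matrix_mult vector_right_mult_matrix mat_def axis_def vec_eq_iff) 
qed

lemma pd_fps_deriv_vec: "pd.Dv b (fps_deriv.Dv v) = fps_deriv.Dv (pd.Dv b v)"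
  by (simp add: vec_eq_iff pdiff.fps_map_fps_deriv)

lemma vec_ode_unique:
  fixes F :: "('n, 'k) mpolynomial fps ^ 'n"
  assumes "fps_deriv.Dv F = - (F v* Q)" "\<And>l. fps_nth (F $ l) 0 = 0"
  shows "F = 0"
proof -
  have "F $ i = 0" for i
  proof (rule fps_linear_ode_unique[where Q = "\<lambda>i j. - Q $ j $ i"])
    show "fps_deriv (F $ i) = (\<Sum>j\<in>UNIV. - Q $ j $ i * F $ j)" for i
      using assms(1) by (simp add: vec_eq_iff vector_matrix_mult_def sum_negf mult.commute)
  qed (use assms(2) mpolynomial_of_nat_mult_eq_0 in auto)
  then show ?thesis by (simp add: vec_eq_iff)
qed

lemma W_nth_0: "fps_nth (W $ i $ j) 0 = 0"
  by (simp add: W_def)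

lemma maurer_cartan: "pd.Dv a (W $ b) - pd.Dv b (W $ a) = lie_brk c (W $ a) (W $ b)"
proof -
  define F where "F = pd.Dv a (W $ b) - pd.Dv b (W $ a) - lie_brk c (W $ a) (W $ b)"
  \<comment> \<open>Apply \<open>pd a\<close> to \<open>W_row_deriv\<close>: the constant vector
    \<open>axis b 1\<close> drops out, and \<open>p\<close> contributes
    \<open>axis a 1\<close>.\<close>
  have 1: "fps_deriv.Dv (pd.Dv a (W $ b)) = - lie_brk c (pd.Dv a (W $ b)) p - lie_brk c (W $ b) (axis a 1)" for a b
  proof -
    have "fps_deriv.Dv (pd.Dv a (W $ b)) = pd.Dv a (axis b 1 - lie_brk c (W $ b) p)"
      by (simp only: pd_fps_deriv_vec[symmetric] W_row_deriv)
    also have "\<dots> = - pd.Dv a (lie_brk c (W $ b) p)"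
      by (auto simp: vec_eq_iff pd.diff axis_def)
    finally show ?thesis by (simp add: pd.lie_brk[OF pd_c] pd_p)
  qed
  have "fps_deriv.Dv F = fps_deriv.Dv (pd.Dv a (W $ b)) - fps_deriv.Dv (pd.Dv b (W $ a)) - fps_deriv.Dv (lie_brk c (W $ a) (W $ b))"
    by (simp add: F_def vec_eq_iff)
  also have "fps_deriv.Dv (lie_brk c (W $ a) (W $ b)) =
     lie_brk c (axis a 1 - lie_brk c (W $ a) p) (W $ b) + lie_brk c (W $ a) (axis b 1 - lie_brk c (W $ b) p)"
    by (simp only: fps_deriv.lie_brk[of c, OF fps_deriv_c] W_row_deriv)
  \<comment> \<open>The brackets with \<open>axis a 1\<close> and \<open>axis b 1\<close> cancel,
    and the Jacobi identity merges the two remaining double brackets into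
    \<open>[[w\<^sub>a, w\<^sub>b], p]\<close>.\<close>
  finally have "fps_deriv.Dv F = - lie_brk c F p"
    using symbols.lie_brk_jacobi[of "W $ a" "W $ b" p] symbols.lie_brk_antisym[of "W $ b" "axis a 1"]
      symbols.lie_brk_antisym[of "W $ b" "lie_brk c (W $ a) p"]
    unfolding 1 F_def lie_brk_linear by (simp add: algebra_simps)
  then have "fps_deriv.Dv F = - (F v* right_mult_matrix c p)"
    by (simp add: vector_right_mult_matrix)
  moreover have "fps_nth (F $ l) 0 = 0" for l
    by (simp add: F_def W_nth_0 lie_brk_def fps_sum_nth)
  ultimately have "F = 0" by (rule vec_ode_unique)
  then show ?thesis by (simp add: F_def)
qed

lemma mat_ode_unique:
  fixes G :: "('n, 'k) mpolynomial fps ^ 'n ^ 'n"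
  assumes "fps_deriv.Dm G = Q ** G" "\<And>i j. fps_nth (G $ i $ j) 0 = 0"
  shows "G = 0"
proof -
  have "G $ i $ j = 0" for i j
  proof (rule fps_linear_ode_unique[where G = "\<lambda>i. G $ i $ j" and Q = "\<lambda>i k. Q $ i $ k"])
    show "fps_deriv (G $ i $ j) = (\<Sum>k\<in>UNIV. Q $ i $ k * G $ k $ j)" for i
      using assms(1) by (simp add: vec_eq_iff matrix_matrix_mult_def)
  qed (use assms(2) mpolynomial_of_nat_mult_eq_0 in auto)
  then show ?thesis by (simp add: vec_eq_iff)
qed

lemma T_deriv: "fps_deriv.Dm T = right_mult_matrix c p ** T"
  by (simp add: pconst.matrix_series_deriv right_mult_matrix_p)

lemma pd_fps_deriv_mat: "pd.Dm b (fps_deriv.Dm M) = fps_deriv.Dm (pd.Dm b M)"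
  by (simp add: vec_eq_iff pdiff.fps_map_fps_deriv)

lemma pd_T: "pd.Dm b T = right_mult_matrix c (W $ b) ** T"
proof -
  let ?R = "right_mult_matrix c"
  define G where "G = pd.Dm b T - ?R (W $ b) ** T"
  have "fps_deriv.Dm (pd.Dm b T) = ?R (axis b 1) ** T + ?R p ** pd.Dm b T"
    unfolding pd_fps_deriv_mat[symmetric] T_deriv pd.matrix_mult pd.right_mult_matrix[of _ c, OF pd_c] pd_p ..
  moreover have "fps_deriv.Dm (?R (W $ b) ** T) =
      (?R (axis b 1) - (?R (W $ b) ** ?R p - ?R p ** ?R (W $ b))) ** T + ?R (W $ b) ** (?R p ** T)"
    unfolding fps_deriv.matrix_mult fps_deriv.right_mult_matrix[of c, OF fps_deriv_c] T_deriv W_row_deriv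
      right_mult_matrix_diff symbols.right_mult_matrix_lie_brk ..
  moreover have "fps_deriv.Dm G = fps_deriv.Dm (pd.Dm b T) - fps_deriv.Dm (?R (W $ b) ** T)"
    by (simp add: G_def vec_eq_iff)
  \<comment> \<open>The terms with \<open>axis b 1\<close> cancel, and
    \<open>?R (W $ b) ** ?R p ** T\<close> cancels one half of the commutator; both remaining terms
    begin with \<open>?R p\<close>.\<close>
  ultimately have "fps_deriv.Dm G = ?R p ** G"
    by (simp add: G_def matrix_diff_ldistrib matrix_diff_rdistrib matrix_add_rdistrib matrix_mul_assoc)
  moreover have "fps_nth (G $ i $ j) 0 = 0" for i j
  proof -
    \<comment> \<open>At \<open>t = 0\<close> the matrix \<open>T\<close> is the identity, whose
      entries are constants, and \<open>W\<close> vanishes.\<close>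
    have "pdiff b (if i = j then 1 else 0) = 0" by simp
    then show ?thesis
      by (simp add: G_def matrix_series_nth matrix_matrix_mult_def fps_sum_nth mat_def
        right_mult_matrix_def W_nth_0)
  qed
  ultimately have "G = 0" by (rule mat_ode_unique)
  then show ?thesis by (simp add: G_def)
qed

lemma T_mult_Tinv: "T ** Tinv = mat 1" "Tinv ** T = mat 1"
  by (simp_all add: pconst.matrix_series_mult[symmetric] fps_exp_add_mult[symmetric] pconst.matrix_series_one)

lemma Psi_mult_Phi: "Psi ** Phi = mat 1" "Phi ** Psi = mat 1"
  by (simp_all add: pconst.matrix_series_mult[symmetric] psi_mult_psi_inv
      psi_mult_psi_inv[unfolded mult.commute[of psi]] pconst.matrix_series_one)

text \<open>Contraction with row \<open>i\<close> of \<open>Psi\<close> replaces the forms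
  \<open>w\<^sub>b\<close> by \<open>t\<close> times the basis vector \<open>axis i 1\<close>; this
  returns the formulas in \<open>W\<close> to plain structure constants.\<close>

lemma Psi_mult_W: "Psi $ i v* W = axis i fps_X"
proof -
  have "(Psi $ i v* W) $ j = fps_X * (Psi ** Phi) $ i $ j" for j
    by (simp add: W_def vector_matrix_mult_def matrix_matrix_mult_def sum_distrib_left mult_ac)
  then show ?thesis by (simp add: Psi_mult_Phi vec_eq_iff mat_def axis_def)
qed

text \<open>Differentiate \<open>A ** B = mat 1\<close> and multiply by \<open>A\<close> from the
  right. It serves for both \<open>Tinv\<close> and \<open>Psi\<close>.\<close>

lemma pd_inverse:
  assumes "A ** B = mat 1" "B ** A = mat 1"
  shows "pd.Dm b A = - (A ** (pd.Dm b B ** A))"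
proof -
  have "pd.Dm b (mat 1) = 0"
    by (auto simp: vec_eq_iff mat_def)
  then have "pd.Dm b A ** B + A ** pd.Dm b B = 0"
    by (simp add: pd.matrix_mult[symmetric] assms)
  then have "(pd.Dm b A ** B + A ** pd.Dm b B) ** A = 0"
    by (simp add: matrix_matrix_mult_def vec_eq_iff)
  then show ?thesis
    by (simp add: matrix_add_rdistrib matrix_mul_assoc[symmetric] assms(2) eq_neg_iff_add_eq_0)
qed

lemma pd_Tinv: "pd.Dm b Tinv = - (Tinv ** right_mult_matrix c (W $ b))"
  unfolding pd_inverse[OF T_mult_Tinv(2,1)] pd_T by (simp add: matrix_mul_assoc[symmetric] T_mult_Tinv)

text \<open>By linearity the sum is \<open>A\<close> of the contracted vector, which is
  \<open>t\<close> times \<open>axis l 1\<close> by \<open>Psi_mult_W\<close>.\<close>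

lemma right_mult_matrix_Psi_W:
  "(\<Sum>b\<in>UNIV. Psi $ l $ b * right_mult_matrix c (W $ b) $ i $ j) = fps_X * c i l j"
proof -
  have "(\<Sum>b\<in>UNIV. Psi $ l $ b * right_mult_matrix c (W $ b) $ i $ j) =
      right_mult_matrix c (Psi $ l v* W) $ i $ j"
    by (simp add: right_mult_matrix_def vector_matrix_mult_def sum_distrib_left sum_distrib_right mult.assoc)
      (rule sum.swap)
  also have "Psi $ l v* W = fps_X *s axis l 1"
    unfolding Psi_mult_W by (simp add: vec_eq_iff axis_def)
  also have "right_mult_matrix c (fps_X *s axis l 1) $ i $ j = fps_X * right_mult_matrix c (axis l 1) $ i $ j"
    by (simp add: right_mult_matrix_def sum_distrib_left mult.assoc)
  finally show ?thesis by (simp add: right_mult_matrix_axis)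
qed

section \<open>The commutation relations at the level of symbols\<close>

text \<open>The left side is the symbol of the commutator of \<open>T_hat C i j\<close> with
  \<open>x_hat C l\<close>; \<open>pd_T\<close> brings in \<open>A(w\<^sub>b)\<close>, which the sum
  over \<open>b\<close> contracts. The factor \<open>fps_X\<close> becomes 1 at
  \<open>t = 1\<close>.\<close>

lemma T_relation:
  "(\<Sum>b\<in>UNIV. pd b (T $ i $ j) * Psi $ l $ b) = fps_X * (\<Sum>a\<in>UNIV. c i l a * T $ a $ j)"
proof -
  have "pd b (T $ i $ j) = (\<Sum>a\<in>UNIV. right_mult_matrix c (W $ b) $ i $ a * T $ a $ j)" for b
    using pd_T[of b] by (simp add: vec_eq_iff matrix_matrix_mult_def)
  then have "(\<Sum>b\<in>UNIV. pd b (T $ i $ j) * Psi $ l $ b) =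
      (\<Sum>b\<in>UNIV. \<Sum>a\<in>UNIV. (Psi $ l $ b * right_mult_matrix c (W $ b) $ i $ a) * T $ a $ j)"
    by (simp add: sum_distrib_right sum_distrib_left mult_ac)
  also have "\<dots> = (\<Sum>a\<in>UNIV. (\<Sum>b\<in>UNIV. Psi $ l $ b * right_mult_matrix c (W $ b) $ i $ a) * T $ a $ j)"
    by (subst sum.swap) (simp only: sum_distrib_right)
  finally show ?thesis by (simp add: right_mult_matrix_Psi_W sum_distrib_left mult.assoc)
qed

lemma Tinv_relation:
  "(\<Sum>b\<in>UNIV. pd b (Tinv $ i $ j) * Psi $ l $ b) = fps_X * (\<Sum>a\<in>UNIV. c l a j * Tinv $ i $ a)"
proof -
  have "pd b (Tinv $ i $ j) = (\<Sum>a\<in>UNIV. - (Tinv $ i $ a * right_mult_matrix c (W $ b) $ a $ j))" for b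
    using pd_Tinv[of b] by (simp add: vec_eq_iff matrix_matrix_mult_def sum_negf)
  then have "(\<Sum>b\<in>UNIV. pd b (Tinv $ i $ j) * Psi $ l $ b) =
      (\<Sum>b\<in>UNIV. \<Sum>a\<in>UNIV. (Psi $ l $ b * right_mult_matrix c (W $ b) $ a $ j) * (- Tinv $ i $ a))"
    by (simp add: sum_distrib_right sum_distrib_left mult_ac)
  also have "\<dots> = (\<Sum>a\<in>UNIV. (\<Sum>b\<in>UNIV. Psi $ l $ b * right_mult_matrix c (W $ b) $ a $ j) * (- Tinv $ i $ a))"
    by (subst sum.swap) (simp only: sum_distrib_right)
  \<comment> \<open>The contraction gives \<open>c a l j\<close>; antisymmetry absorbs the minus
    sign that comes from differentiating an inverse.\<close>
  also have "\<dots> = (\<Sum>a\<in>UNIV. fps_X * (c l a j * Tinv $ i $ a))"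
    unfolding right_mult_matrix_Psi_W by (intro sum.cong refl, subst symbols.antisym) simp
  finally show ?thesis by (simp add: sum_distrib_left)
qed

text \<open>The Maurer-Cartan equation for \<open>W\<close>, which is \<open>t\<close> times
  \<open>Phi\<close>, divided by \<open>t\<close>: the bracket carries two factors \<open>t\<close>,
  so one remains.\<close>

lemma pd_Phi: "pd a (Phi $ b $ d) - pd b (Phi $ a $ d) = fps_X * lie_brk c (Phi $ a) (Phi $ b) $ d"
proof -
  have W: "W $ a = fps_X *s Phi $ a" for a
    by (simp add: W_def vec_eq_iff)
  have "fps_X * (pd a (Phi $ b $ d) - pd b (Phi $ a $ d)) = (pd.Dv a (W $ b) - pd.Dv b (W $ a)) $ d"
    by (simp add: W_def pdiff.fps_map_X_mult right_diff_distrib)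
  also have "\<dots> = fps_X * (fps_X * lie_brk c (Phi $ a) (Phi $ b) $ d)"
    unfolding maurer_cartan unfolding W by (simp add: lie_brk_scale_left lie_brk_scale_right)
  finally show ?thesis by (metis (no_types, lifting) fps_ext fps_X_mult_nth diff_Suc_1 nat.distinct(1))
qed

text \<open>The rows of \<open>Psi\<close> are dual to the coframe given by \<open>Phi\<close>, so
  the structure equation \<open>pd_Phi\<close> turns into a bracket relation for them. The left side
  is the coefficient of \<open>x\<^sub>a\<close> in the commutator of \<open>x_hat C i\<close> and
  \<open>x_hat C j\<close>.\<close>

lemma Psi_relation:
  "(\<Sum>b\<in>UNIV. pd b (Psi $ i $ a) * Psi $ j $ b - pd b (Psi $ j $ a) * Psi $ i $ b) =
    fps_X * (\<Sum>d\<in>UNIV. c i j d * Psi $ d $ a)"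
proof -
  \<comment> \<open>The derivative of \<open>Phi\<close> contracted with two rows of
    \<open>Psi\<close>. Antisymmetrised in \<open>i\<close> and \<open>j\<close> it is governed by
    \<open>pd_Phi\<close>, where the contractions \<open>Psi $ i v* Phi\<close> collapse to basis
    vectors.\<close>
  define Y where "Y i j d = (\<Sum>g\<in>UNIV. \<Sum>b\<in>UNIV. Psi $ i $ g * Psi $ j $ b * pd b (Phi $ g $ d))" for i j d
  have pd_Psi: "pd b (Psi $ i $ a) = - (\<Sum>d\<in>UNIV. \<Sum>g\<in>UNIV. Psi $ i $ g * pd b (Phi $ g $ d) * Psi $ d $ a)" for b i
    using pd_inverse[OF Psi_mult_Phi, of b]
    by (simp add: vec_eq_iff matrix_mul_assoc) (simp add: matrix_matrix_mult_def sum_distrib_right)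
  have 1: "(\<Sum>b\<in>UNIV. pd b (Psi $ i $ a) * Psi $ j $ b) = - (\<Sum>d\<in>UNIV. Y i j d * Psi $ d $ a)" for i j
  proof -
    have "(\<Sum>b\<in>UNIV. pd b (Psi $ i $ a) * Psi $ j $ b) =
        - (\<Sum>b\<in>UNIV. \<Sum>d\<in>UNIV. \<Sum>g\<in>UNIV. Psi $ i $ g * Psi $ j $ b * pd b (Phi $ g $ d) * Psi $ d $ a)"
      unfolding pd_Psi mult_minus_left sum_negf sum_distrib_right
      by (intro arg_cong[where f = uminus] sum.cong refl) (simp only: mult_ac)
    also have "\<dots> = - (\<Sum>d\<in>UNIV. \<Sum>b\<in>UNIV. \<Sum>g\<in>UNIV. Psi $ i $ g * Psi $ j $ b * pd b (Phi $ g $ d) * Psi $ d $ a)"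
      by (subst sum.swap) (rule refl)
    also have "\<dots> = - (\<Sum>d\<in>UNIV. Y i j d * Psi $ d $ a)"
      unfolding Y_def sum_distrib_right
      by (rule arg_cong[where f = uminus], rule sum.cong[OF refl], rule sum.swap)
    finally show ?thesis .
  qed
  have row_Psi: "Psi $ i v* Phi = axis i 1" for i
    unfolding row_matrix_mult[symmetric] Psi_mult_Phi by (simp add: mat_def axis_def vec_eq_iff)
  have 2: "Y j i d - Y i j d = fps_X * c i j d" for d
  proof -
    have "Y j i d = (\<Sum>g\<in>UNIV. \<Sum>b\<in>UNIV. Psi $ i $ g * Psi $ j $ b * pd g (Phi $ b $ d))"
      unfolding Y_def by (subst sum.swap) (simp only: mult_ac)
    then have "Y j i d - Y i j d = (\<Sum>g\<in>UNIV. \<Sum>b\<in>UNIV. Psi $ i $ g * Psi $ j $ b * (pd g (Phi $ b $ d) - pd b (Phi $ g $ d)))"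
      by (simp add: Y_def sum_subtractf right_diff_distrib)
    also have "\<dots> = fps_X * lie_brk c (Psi $ i v* Phi) (Psi $ j v* Phi) $ d"
      unfolding pd_Phi lie_brk_vector_matrix_mult by (simp add: sum_distrib_left mult_ac)
    finally show ?thesis by (simp add: row_Psi lie_brk_axis)
  qed
  have "(\<Sum>b\<in>UNIV. pd b (Psi $ i $ a) * Psi $ j $ b - pd b (Psi $ j $ a) * Psi $ i $ b) =
      (\<Sum>d\<in>UNIV. (Y j i d - Y i j d) * Psi $ d $ a)"
    by (simp add: sum_subtractf 1 left_diff_distrib)
  then show ?thesis unfolding 2 by (simp add: sum_distrib_left mult.assoc)
qed

end

section \<open>Symbols as elements of the Weyl algebra\<close>

lemma weyl_act_0_right: "weyl_act A 0 = 0"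
  using weyl_act_add_right[of A 0 0] by simp

lemma weyl_act_sum_right: "weyl_act A (sum g S) = (\<Sum>s\<in>S. weyl_act A (g s))"
  by (induction S rule: infinite_finite_induct) (simp_all add: weyl_act_0_right weyl_act_add_right)

lemma weyl_act_sum: "weyl_act (sum g S) f = (\<Sum>s\<in>S. weyl_act (g s) f)"
  by (induction S rule: infinite_finite_induct) (simp_all add: weyl_act_zero weyl_act_add)

text \<open>The operator with symbol \<open>q\<close>: the multi-indices of \<open>q\<close> become
  exponents of \<open>\<partial>\<close>, with coefficients constant in \<open>x\<close>.\<close>

definition weyl_of :: "('n, 'k::field_char_0) mpolynomial \<Rightarrow> ('n::finite, 'k) weyl" where
  "weyl_of q = Weyl (\<lambda>b. Poly_Mapping.single 0 (Poly_Mapping.lookup q b))"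

lemma weyl_coeff_weyl_of: "weyl_coeff (weyl_of q) b = Poly_Mapping.single 0 (Poly_Mapping.lookup q b)"
  by (simp add: weyl_of_def Weyl_inverse)

lemma weyl_of_zero: "weyl_of 0 = 0"
  by (rule weyl_eqI) (simp add: weyl_coeff_weyl_of zero_weyl.rep_eq)

lemma weyl_of_add: "weyl_of (p + q) = weyl_of p + weyl_of q"
  by (rule weyl_eqI) (simp add: weyl_coeff_weyl_of plus_weyl.rep_eq lookup_add single_add)

lemma weyl_of_sum: "weyl_of (sum g S) = (\<Sum>s\<in>S. weyl_of (g s))"
  by (induction S rule: infinite_finite_induct) (simp_all add: weyl_of_zero weyl_of_add)

lemma weyl_act_weyl_of_single:
  "weyl_act (weyl_of (Poly_Mapping.single b x)) f = Poly_Mapping.single 0 x * mderiv b f"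
  by (rule weyl_act_single) (auto simp: weyl_coeff_weyl_of lookup_single when_def)

lemma mderiv_const_mult: "mderiv k (Poly_Mapping.single 0 x * f) = Poly_Mapping.single 0 x * mderiv k f"
proof -
  have "Poly_Mapping.lookup (Poly_Mapping.single 0 x * f) a = x * Poly_Mapping.lookup f a" for a and f :: "('a, 'b) mpolynomial"
    unfolding Poly_Mapping_map_times[symmetric] by (simp add: map.rep_eq when_def)
  then show ?thesis by (intro poly_mapping_eqI) (simp add: lookup_mderiv)
qed

lemma weyl_of_single_mult:
  "weyl_of (Poly_Mapping.single a x * Poly_Mapping.single b y) =
    weyl_of (Poly_Mapping.single a x) * weyl_of (Poly_Mapping.single b y)"
proof (rule weyl_act_eqI)
  fix f
  have "Poly_Mapping.single 0 (x * y) = Poly_Mapping.single 0 x * (Poly_Mapping.single 0 y :: ('a, 'b) mpolynomial)"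
    by (simp add: mult_single)
  then show "weyl_act (weyl_of (Poly_Mapping.single a x * Poly_Mapping.single b y)) f =
      weyl_act (weyl_of (Poly_Mapping.single a x) * weyl_of (Poly_Mapping.single b y)) f"
    by (simp add: mult_single[of a] weyl_act_weyl_of_single weyl_act_times mderiv_const_mult mderiv_mderiv mult.assoc)
qed

lemma weyl_of_mult: "weyl_of (p * q) = weyl_of p * weyl_of q"
proof -
  let ?P = "\<lambda>p a. Poly_Mapping.single a (Poly_Mapping.lookup p a)"
  have "weyl_of ((\<Sum>a\<in>Poly_Mapping.keys p. ?P p a) * (\<Sum>a\<in>Poly_Mapping.keys q. ?P q a)) =
      weyl_of (\<Sum>a\<in>Poly_Mapping.keys p. ?P p a) * weyl_of (\<Sum>a\<in>Poly_Mapping.keys q. ?P q a)"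
    unfolding sum_product weyl_of_sum weyl_of_single_mult ..
  then show ?thesis by (simp flip: mpolynomial_sum_single)
qed

lemma weyl_scale_eq: "weyl_scale x A = weyl_of (Poly_Mapping.single 0 x) * A"
  by (rule weyl_act_eqI) (simp add: weyl_act_scale weyl_act_times weyl_act_weyl_of_single)

lemma weyl_act_const_mult: "weyl_act A (Poly_Mapping.single 0 x * f) = Poly_Mapping.single 0 x * weyl_act A f"
  unfolding weyl_act_def mderiv_const_mult
  by (subst Sum_any_right_distrib[OF finite_weyl_act]) (simp add: mult_ac)

lemma weyl_scale_times_right: "A * weyl_scale r B = weyl_scale r (A * B)"
  by (rule weyl_act_eqI) (simp add: weyl_act_times weyl_act_scale weyl_act_const_mult)

lemma weyl_of_var: "weyl_of (var i) = weyl_d i"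
  by (rule weyl_act_eqI) (simp add: var_def weyl_act_weyl_of_single weyl_act_d)

lemma weyl_of_const: "weyl_of (Poly_Mapping.single 0 x) = weyl_scale x 1"
  by (simp add: weyl_scale_eq)

lemma weyl_of_one: "weyl_of 1 = 1"
proof (rule weyl_act_eqI)
  fix f :: "('a, 'b) mpolynomial"
  have "weyl_act (weyl_of (Poly_Mapping.single 0 1)) f = f"
    unfolding weyl_act_weyl_of_single by simp
  then show "weyl_act (weyl_of 1) f = weyl_act 1 f" by (simp add: weyl_act_one)
qed

section \<open>Commutation with x as differentiation of symbols\<close>

lemma commutator_mult_left: "commutator (a * b) x = a * commutator b x + commutator a x * b"
  by (simp add: commutator_def algebra_simps)

lemma commutator_sum_left: "commutator (sum f S) x = (\<Sum>s\<in>S. commutator (f s) x)"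
  by (simp add: commutator_def sum_distrib_left sum_distrib_right sum_subtractf)

text \<open>Both sides obey the product rule, so induction on the total degree, splitting off one
  variable, reduces the claim to the commutator of \<open>\<partial>\<^sub>j\<close> with
  \<open>x\<^sub>i\<close>.\<close>

lemma commutator_weyl_of_single:
  "commutator (weyl_of (Poly_Mapping.single b y)) (weyl_x i) = weyl_of (pdiff i (Poly_Mapping.single b y))"
proof (induction "\<Sum>i\<in>UNIV. Poly_Mapping.lookup b i" arbitrary: b rule: less_induct)
  case less
  show ?case
  proof (cases "b = 0")
    case True
    then show ?thesis
      by (simp add: weyl_of_const pdiff_const weyl_of_zero commutator_def weyl_scale_times_left weyl_scale_times_right)
  next
    case False
    then obtain j where j: "Poly_Mapping.lookup b j \<noteq> 0"
      by (metis lookup_zero poly_mapping_eqI)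
    define d where "d = b - Poly_Mapping.single j 1"
    have b: "b = Poly_Mapping.single j 1 + d"
      unfolding d_def using j by (intro poly_mapping_eqI) (auto simp: lookup_add lookup_minus lookup_single when_def)
    have "(\<Sum>i\<in>UNIV. Poly_Mapping.lookup b i) = 1 + (\<Sum>i\<in>UNIV. Poly_Mapping.lookup d i)"
      unfolding b by (simp add: lookup_add sum.distrib lookup_single when_def)
    then have IH: "commutator (weyl_of (Poly_Mapping.single d y)) (weyl_x i) = weyl_of (pdiff i (Poly_Mapping.single d y))"
      by (intro less) simp
    have "Poly_Mapping.single b y = var j * Poly_Mapping.single d y"
      by (simp add: b var_def mult_single)
    then show ?thesis
      by (simp add: weyl_of_mult commutator_mult_left IH weyl_of_var weyl_commutation_relations(3)
          pdiff_mult weyl_of_add pdiff_var weyl_of_zero weyl_of_one add.commute)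
  qed
qed

lemma commutator_weyl_of: "commutator (weyl_of q) (weyl_x i) = weyl_of (pdiff i q)"
proof -
  let ?P = "\<lambda>a. Poly_Mapping.single a (Poly_Mapping.lookup q a)"
  have "commutator (weyl_of (\<Sum>a\<in>Poly_Mapping.keys q. ?P a)) (weyl_x i) = weyl_of (pdiff i (\<Sum>a\<in>Poly_Mapping.keys q. ?P a))"
    unfolding weyl_of_sum commutator_sum_left pdiff.sum commutator_weyl_of_single ..
  then show ?thesis by (simp flip: mpolynomial_sum_single)
qed

section \<open>Evaluation of symbol series at t = 1\<close>

text \<open>\<open>evals F A\<close> says that setting the power series variable to \<open>1\<close> in \<open>F\<close> gives \<open>A\<close>: applied to a fixed
  polynomial, the sum of the coefficients is finite.\<close>

definition evals :: "('n, 'k::field_char_0) mpolynomial fps \<Rightarrow> ('n::finite, 'k) weyl \<Rightarrow> bool" where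
  "evals F A \<longleftrightarrow> (\<forall>f. \<exists>N. (\<forall>k\<ge>N. weyl_act (weyl_of (fps_nth F k)) f = 0) \<and>
    weyl_act A f = (\<Sum>k<N. weyl_act (weyl_of (fps_nth F k)) f))"

text \<open>Any larger cutoff works too, so that several evaluations can share one.\<close>

lemma evals_eventually:
  assumes "evals F A"
  obtains N where "\<And>k. k \<ge> N \<Longrightarrow> weyl_act (weyl_of (fps_nth F k)) f = 0"
    "\<And>n. n \<ge> N \<Longrightarrow> weyl_act A f = (\<Sum>k<n. weyl_act (weyl_of (fps_nth F k)) f)"
proof -
  obtain N where N: "\<And>k. k \<ge> N \<Longrightarrow> weyl_act (weyl_of (fps_nth F k)) f = 0"
    "weyl_act A f = (\<Sum>k<N. weyl_act (weyl_of (fps_nth F k)) f)"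
    using assms unfolding evals_def by blast
  have "(\<Sum>k<n. weyl_act (weyl_of (fps_nth F k)) f) = (\<Sum>k<N. weyl_act (weyl_of (fps_nth F k)) f)" if "n \<ge> N" for n
    by (rule sum.mono_neutral_right) (use that N(1) in auto)
  with N that show ?thesis by metis
qed

text \<open>The transfer principle: equal series have equal values, because the action on
  polynomials is faithful. Every operator identity obtained from symbols goes through it.\<close>

lemma evals_unique:
  assumes "evals F A" "evals F B"
  shows "A = B"
proof (rule weyl_act_eqI)
  fix f
  obtain N where "\<And>n. n \<ge> N \<Longrightarrow> weyl_act A f = (\<Sum>k<n. weyl_act (weyl_of (fps_nth F k)) f)"
    using evals_eventually[OF assms(1)] by metis
  moreover obtain M where "\<And>n. n \<ge> M \<Longrightarrow> weyl_act B f = (\<Sum>k<n. weyl_act (weyl_of (fps_nth F k)) f)"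
    using evals_eventually[OF assms(2)] by metis
  ultimately show "weyl_act A f = weyl_act B f"
    by (metis max.cobounded1 max.cobounded2)
qed

lemma evals_const: "evals (fps_const q) (weyl_of q)"
  unfolding evals_def by (intro allI exI[of _ 1]) (auto simp: weyl_of_zero weyl_act_zero)

lemma evals_X: "evals fps_X 1"
  unfolding evals_def
  by (intro allI exI[of _ 2]) (auto simp: weyl_of_zero weyl_act_zero weyl_of_one weyl_act_one numeral_2_eq_2 fps_X_def)

lemma evals_add:
  assumes "evals F A" "evals G B"
  shows "evals (F + G) (A + B)"
  unfolding evals_def
proof
  fix f
  obtain N where N: "\<And>k. k \<ge> N \<Longrightarrow> weyl_act (weyl_of (fps_nth F k)) f = 0"
      "\<And>n. n \<ge> N \<Longrightarrow> weyl_act A f = (\<Sum>k<n. weyl_act (weyl_of (fps_nth F k)) f)"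
    using evals_eventually[OF assms(1)] by metis
  obtain M where M: "\<And>k. k \<ge> M \<Longrightarrow> weyl_act (weyl_of (fps_nth G k)) f = 0"
      "\<And>n. n \<ge> M \<Longrightarrow> weyl_act B f = (\<Sum>k<n. weyl_act (weyl_of (fps_nth G k)) f)"
    using evals_eventually[OF assms(2)] by metis
  show "\<exists>L. (\<forall>k\<ge>L. weyl_act (weyl_of (fps_nth (F + G) k)) f = 0) \<and>
      weyl_act (A + B) f = (\<Sum>k<L. weyl_act (weyl_of (fps_nth (F + G) k)) f)"
    using N(1) M(1) N(2)[of "max M N"] M(2)[of "max M N"]
    by (intro exI[of _ "max M N"]) (simp add: weyl_of_add weyl_act_add sum.distrib)
qed

lemma evals_zero: "evals 0 0"
  using evals_const[of 0] by (simp add: weyl_of_zero)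

lemma evals_sum: "(\<And>s. s \<in> S \<Longrightarrow> evals (F s) (A s)) \<Longrightarrow> evals (sum F S) (sum A S)"
  by (induction S rule: infinite_finite_induct) (simp_all add: evals_zero evals_add)

text \<open>On a fixed \<open>f\<close> the terms of \<open>G\<close> stop at \<open>M\<close>, and
  for each of these finitely many terms the terms of \<open>F\<close> stop as well. The product is
  thus a sum over a finite rectangle, regrouped along antidiagonals.\<close>

lemma evals_mult:
  assumes "evals F A" "evals G B"
  shows "evals (F * G) (A * B)"
  unfolding evals_def
proof
  fix f
  define h where "h i j = weyl_act (weyl_of (fps_nth F i)) (weyl_act (weyl_of (fps_nth G j)) f)" for i j
  obtain M where M: "\<And>k. k \<ge> M \<Longrightarrow> weyl_act (weyl_of (fps_nth G k)) f = 0"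
      "weyl_act B f = (\<Sum>k<M. weyl_act (weyl_of (fps_nth G k)) f)"
    using evals_eventually[OF assms(2)] by (metis order_refl)
  have "\<exists>N. (\<forall>i\<ge>N. h i j = 0) \<and>
      (\<forall>n\<ge>N. weyl_act A (weyl_act (weyl_of (fps_nth G j)) f) = (\<Sum>i<n. h i j))" for j
    unfolding h_def using evals_eventually[OF assms(1)] by metis
  then obtain N' where N': "\<And>i j. i \<ge> N' j \<Longrightarrow> h i j = 0"
      "\<And>n j. n \<ge> N' j \<Longrightarrow> weyl_act A (weyl_act (weyl_of (fps_nth G j)) f) = (\<Sum>i<n. h i j)"
    by metis
  \<comment> \<open>A sum instead of a maximum, as a simple common bound for all \<open>N' j\<close>
    with \<open>j < M\<close>.\<close>
  define N where "N = (\<Sum>j<M. N' j)"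
  have NN: "N' j \<le> N" if "j < M" for j
    unfolding N_def by (rule member_le_sum) (use that in auto)
  have h0: "h i j = 0" if "\<not> (i < N \<and> j < M)" for i j
  proof (cases "j < M")
    case True
    then show ?thesis using that NN[OF True] by (intro N'(1)) auto
  next
    case False
    then show ?thesis using M(1)[of j] by (simp add: h_def weyl_act_0_right)
  qed
  have nth: "weyl_act (weyl_of (fps_nth (F * G) n)) f = (\<Sum>i\<le>n. h i (n - i))" for n
    by (simp add: fps_mult_nth weyl_of_sum weyl_of_mult weyl_act_sum weyl_act_times h_def atLeast0AtMost)
  have "weyl_act (A * B) f = (\<Sum>j<M. \<Sum>i<N. h i j)"
    unfolding weyl_act_times M(2) weyl_act_sum_right by (intro sum.cong refl N'(2) NN) simp
  also have "\<dots> = (\<Sum>(i, j)\<in>{..<N} \<times> {..<M}. h i j)"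
    by (subst sum.swap) (simp add: sum.cartesian_product)
  \<comment> \<open>The triangle contains the rectangle, and \<open>h\<close> vanishes on the
    difference.\<close>
  also have "\<dots> = (\<Sum>(i, j)\<in>{(i, j). i + j < M + N}. h i j)"
  proof (rule sum.mono_neutral_left)
    show "finite {(i, j). i + j < M + N}"
      by (rule finite_subset[of _ "{..<M + N} \<times> {..<M + N}"]) auto
    show "\<forall>z\<in>{(i, j). i + j < M + N} - {..<N} \<times> {..<M}. (case z of (i, j) \<Rightarrow> h i j) = 0"
      using h0 by auto
  qed auto
  also have "\<dots> = (\<Sum>n<M + N. \<Sum>i\<le>n. h i (n - i))"
    by (rule sum.triangle_reindex)
  finally have "weyl_act (A * B) f = (\<Sum>n<M + N. weyl_act (weyl_of (fps_nth (F * G) n)) f)"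
    by (simp add: nth)
  moreover have "weyl_act (weyl_of (fps_nth (F * G) n)) f = 0" if "n \<ge> M + N" for n
    unfolding nth using that by (intro sum.neutral ballI h0) auto
  ultimately show "\<exists>L. (\<forall>k\<ge>L. weyl_act (weyl_of (fps_nth (F * G) k)) f = 0) \<and>
      weyl_act (A * B) f = (\<Sum>k<L. weyl_act (weyl_of (fps_nth (F * G) k)) f)"
    by blast
qed

lemma evals_uminus:
  assumes "evals F A"
  shows "evals (- F) (- A)"
proof -
  have "weyl_of (- 1) = (- 1 :: ('a, 'b) weyl)"
    using weyl_of_add[of "- 1" 1] by (simp add: weyl_of_zero weyl_of_one eq_neg_iff_add_eq_0)
  then have "evals (fps_const (- 1) * F) (- 1 * A)"
    using evals_mult[OF evals_const assms] by metis
  moreover have "fps_const (- 1) * F = - F" by (simp add: fps_eq_iff)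
  ultimately show ?thesis by simp
qed

lemma evals_diff: "evals F A \<Longrightarrow> evals G B \<Longrightarrow> evals (F - G) (A - B)"
  using evals_add[OF _ evals_uminus] by fastforce

text \<open>Coefficientwise this is \<open>commutator_weyl_of\<close>. Expanding the commutator
  needs one cutoff for \<open>f\<close> and one for \<open>x\<^sub>i f\<close>.\<close>

lemma evals_pdiff:
  assumes "evals F A"
  shows "evals (fps_map (pdiff i) F) (commutator A (weyl_x i))"
  unfolding evals_def
proof
  fix f
  let ?x = "weyl_x i :: ('a, 'b) weyl"
  obtain N where N: "\<And>k. k \<ge> N \<Longrightarrow> weyl_act (weyl_of (fps_nth F k)) f = 0"
      "\<And>n. n \<ge> N \<Longrightarrow> weyl_act A f = (\<Sum>k<n. weyl_act (weyl_of (fps_nth F k)) f)"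
    using evals_eventually[OF assms] by metis
  obtain M where M: "\<And>k. k \<ge> M \<Longrightarrow> weyl_act (weyl_of (fps_nth F k)) (weyl_act ?x f) = 0"
      "\<And>n. n \<ge> M \<Longrightarrow> weyl_act A (weyl_act ?x f) = (\<Sum>k<n. weyl_act (weyl_of (fps_nth F k)) (weyl_act ?x f))"
    using evals_eventually[OF assms] by metis
  have nth: "weyl_act (weyl_of (fps_nth (fps_map (pdiff i) F) k)) f =
      weyl_act (weyl_of (fps_nth F k)) (weyl_act ?x f) - weyl_act ?x (weyl_act (weyl_of (fps_nth F k)) f)" for k
    by (simp add: commutator_weyl_of[symmetric] commutator_def weyl_act_diff weyl_act_times)
  show "\<exists>L. (\<forall>k\<ge>L. weyl_act (weyl_of (fps_nth (fps_map (pdiff i) F) k)) f = 0) \<and>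
      weyl_act (commutator A ?x) f = (\<Sum>k<L. weyl_act (weyl_of (fps_nth (fps_map (pdiff i) F) k)) f)"
    using N(1) M(1) N(2)[of "max M N"] M(2)[of "max M N"] unfolding nth
    by (intro exI[of _ "max M N"])
      (simp add: commutator_def weyl_act_diff weyl_act_times weyl_act_0_right weyl_act_sum_right sum_subtractf)
qed

text \<open>\<open>weyl_sum\<close> is finite at each \<open>\<partial>\<^sup>b\<close>, whereas
  \<open>evals\<close> asks for finiteness on each polynomial \<open>f\<close>. Only finitely many
  \<open>b\<close> act nontrivially on \<open>f\<close>, which gives a common cutoff.\<close>

lemma evals_weyl_sum:
  assumes fin: "\<And>b. finite {k. Poly_Mapping.lookup (fps_nth F k) b \<noteq> 0}"
  shows "evals F (weyl_sum (\<lambda>k. weyl_of (fps_nth F k)))"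
  unfolding evals_def
proof
  fix f :: "('a, 'b) mpolynomial"
  define K where "K = {b. mderiv b f \<noteq> 0}"
  have K: "finite K" unfolding K_def by (rule finite_mderiv)
  then have "finite (\<Union>b\<in>K. {k. Poly_Mapping.lookup (fps_nth F k) b \<noteq> 0})" using fin by blast
  then obtain N where "(\<Union>b\<in>K. {k. Poly_Mapping.lookup (fps_nth F k) b \<noteq> 0}) \<subseteq> {..<N}"
    by (metis finite_nat_iff_bounded)
  then have N: "Poly_Mapping.lookup (fps_nth F k) b = 0" if "b \<in> K" "k \<ge> N" for b k
    using that by fastforce
  have act: "weyl_act A f = (\<Sum>b\<in>K. weyl_coeff A b * mderiv b f)" for A
    unfolding weyl_act_def by (rule Sum_any.expand_superset[OF K]) (auto simp: K_def)
  have "Sum_any (\<lambda>k. Poly_Mapping.single 0 (Poly_Mapping.lookup (fps_nth F k) b)) =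
      (\<Sum>k<N. Poly_Mapping.single 0 (Poly_Mapping.lookup (fps_nth F k) b) :: ('a, 'b) mpolynomial)"
    if "b \<in> K" for b
  proof (rule Sum_any.expand_superset)
    show "{k. (Poly_Mapping.single 0 (Poly_Mapping.lookup (fps_nth F k) b) :: ('a, 'b) mpolynomial) \<noteq> 0} \<subseteq> {..<N}"
      using N[OF that] by (metis (mono_tags, lifting) lessThan_iff linorder_not_less mem_Collect_eq single_zero subsetI)
  qed simp
  then have "weyl_act (weyl_sum (\<lambda>k. weyl_of (fps_nth F k))) f =
      (\<Sum>b\<in>K. \<Sum>k<N. Poly_Mapping.single 0 (Poly_Mapping.lookup (fps_nth F k) b) * mderiv b f)"
    unfolding act by (intro sum.cong refl) (simp add: weyl_sum_def Weyl_inverse weyl_coeff_weyl_of sum_distrib_right)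
  also have "\<dots> = (\<Sum>k<N. weyl_act (weyl_of (fps_nth F k)) f)"
    unfolding act weyl_coeff_weyl_of by (rule sum.swap)
  finally have "weyl_act (weyl_sum (\<lambda>k. weyl_of (fps_nth F k))) f = (\<Sum>k<N. weyl_act (weyl_of (fps_nth F k)) f)" .
  moreover have "weyl_act (weyl_of (fps_nth F k)) f = 0" if "k \<ge> N" for k
    unfolding act weyl_coeff_weyl_of using N[OF _ that] by simp
  ultimately show "\<exists>N. (\<forall>k\<ge>N. weyl_act (weyl_of (fps_nth F k)) f = 0) \<and>
      weyl_act (weyl_sum (\<lambda>k. weyl_of (fps_nth F k))) f = (\<Sum>k<N. weyl_act (weyl_of (fps_nth F k)) f)"
    by blast
qed

text \<open>Multiplication of symbol series is commutative, and both orders have the same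
  value.\<close>

lemma evals_commute:
  assumes "evals F A" "evals G B"
  shows "A * B = B * A"
  by (rule evals_unique[OF evals_mult[OF assms]]) (subst mult.commute, rule evals_mult[OF assms(2,1)])

lemma commutator_mult_right: "commutator x (a * b) = commutator x a * b + a * commutator x b"
  by (simp add: commutator_def algebra_simps)

lemma commutator_sum_right: "commutator x (sum f S) = (\<Sum>s\<in>S. commutator x (f s))"
  by (simp add: commutator_def sum_distrib_left sum_distrib_right sum_subtractf)

lemma commutator_swap: "commutator x y = - commutator y x"
  by (simp add: commutator_def)

lemma weyl_scale_sum: "weyl_scale r (sum f S) = (\<Sum>s\<in>S. weyl_scale r (f s))"
  for f :: "'i \<Rightarrow> ('n::finite, 'k::field_char_0) weyl"
  by (simp add: weyl_scale_eq sum_distrib_left)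

lemma weyl_scale_uminus: "weyl_scale (- r) A = - weyl_scale r A"
  by (rule weyl_eqI) (simp add: weyl_scale.rep_eq uminus_weyl.rep_eq Poly_Mapping_map_times single_uminus)

lemma weyl_scale_weyl_scale: "weyl_scale r (weyl_scale s A) = weyl_scale (r * s) A"
  for A :: "('n::finite, 'k::field_char_0) weyl"
  unfolding weyl_scale_eq mult.assoc[symmetric] weyl_of_mult[symmetric] by (simp add: mult_single)

lemma weyl_scale_one: "weyl_scale 1 A = A"
  for A :: "('n::finite, 'k::field_char_0) weyl"
  by (simp add: weyl_scale_eq weyl_of_one)

lemma weyl_scale_uminus_right: "weyl_scale r (- A) = - weyl_scale r A"
  for A :: "('n::finite, 'k::field_char_0) weyl"
  by (simp add: weyl_scale_eq)

lemma matrix_pow_uminus: "matrix_pow (- M) k $ i $ j = weyl_scale ((- 1) ^ k) (matrix_pow M k $ i $ j)"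
proof (induction k arbitrary: i j)
  case 0
  then show ?case by (simp add: mat_def weyl_scale_one)
next
  case (Suc k)
  then show ?case
    by (simp add: matrix_matrix_mult_def weyl_scale_times_right weyl_scale_uminus weyl_scale_uminus_right weyl_scale_sum sum_negf)
qed

text \<open>\<open>Tinv_hat\<close> uses the exponential at \<open>-C\<close>, the symbols use
  \<open>exp(-t)\<close> at \<open>C\<close>; the signs of the matrix powers move into the
  coefficients.\<close>

lemma matrix_fps_uminus_exp: "matrix_fps (fps_exp 1) (- M) = matrix_fps (fps_exp (- 1)) M"
  by (simp add: matrix_fps_def matrix_pow_uminus weyl_scale_weyl_scale)

text \<open>Removes the factor \<open>fps_X\<close> left over in the symbol relations.\<close>

lemma evals_X_mult:
  assumes "evals F A"
  shows "evals (fps_X * F) A"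
proof -
  have "evals (fps_X * F) (1 * A)" by (rule evals_mult[OF evals_X assms])
  then show ?thesis by (simp only: mult_1_left)
qed

section \<open>The defining relations in the Weyl algebra\<close>

context lie_symbol_calculus
begin

lemma structure_matrix_symbol: "structure_matrix C $ i $ j = weyl_of (symbol $ i $ j)"
  by (simp add: structure_matrix_def symbol_def weyl_of_sum weyl_of_mult weyl_of_var weyl_scale_eq)

lemma matrix_pow_structure_matrix: "matrix_pow (structure_matrix C) k $ i $ j = weyl_of (matrix_pow symbol k $ i $ j)"
  by (induction k arbitrary: i j)
    (auto simp: mat_def weyl_of_one weyl_of_zero matrix_matrix_mult_def weyl_of_sum weyl_of_mult structure_matrix_symbol)

text \<open>The coefficient of \<open>t^k\<close> is the symbol of the summand of index
  \<open>k\<close> in \<open>matrix_fps\<close>. Finiteness holds because the \<open>k\<close>-th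
  matrix power has no terms of order below \<open>k\<close>.\<close>

lemma evals_series: "evals (series F $ i $ j) (matrix_fps F (structure_matrix C) $ i $ j)"
proof -
  have nth: "weyl_scale (fps_nth F k) (matrix_pow (structure_matrix C) k $ i $ j) = weyl_of (fps_nth (series F $ i $ j) k)" for k
    by (simp add: weyl_scale_eq matrix_pow_structure_matrix weyl_of_mult matrix_series_nth)
  have single_0: "Poly_Mapping.single 0 x \<noteq> (0 :: ('n, 'k) mpolynomial)" if "x \<noteq> 0" for x
    using that by (metis lookup_single_eq lookup_zero)
  have "finite {k. Poly_Mapping.lookup (fps_nth (series F $ i $ j) k) b \<noteq> 0}" for b
    using finite_matrix_pow_structure_matrix[of "fps_nth F" C i j b]
    unfolding nth weyl_coeff_weyl_of by (rule rev_finite_subset) (use single_0 in blast)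
  from evals_weyl_sum[OF this] show ?thesis by (simp add: matrix_fps_def nth)
qed

lemma evals_T: "evals (T $ i $ j) (T_hat C i j)"
  and evals_Tinv: "evals (Tinv $ i $ j) (Tinv_hat C i j)"
  unfolding T_hat_def Tinv_hat_def matrix_fps_uminus_exp by (rule evals_series)+

lemma evals_c: "evals F A \<Longrightarrow> evals (c i j l * F) (weyl_scale (C i j l) A)"
  unfolding c_def weyl_scale_eq by (rule evals_mult[OF evals_const])

text \<open>\<open>A\<close> commutes with the entries of \<open>psi(C)\<close>, so only its
  commutators with the \<open>weyl_x b\<close> survive, and these are derivatives of
  \<open>F\<close>.\<close>

lemma commutator_x_hat:
  assumes "evals F A"
  shows "evals (\<Sum>b\<in>UNIV. pd b F * Psi $ l $ b) (commutator A (x_hat C l))"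
proof -
  have "commutator A (x_hat C l) =
      (\<Sum>b\<in>UNIV. commutator A (weyl_x b) * matrix_fps psi (structure_matrix C) $ l $ b)"
    unfolding x_hat_def commutator_sum_right commutator_mult_right
    using evals_commute[OF assms evals_series] by (simp add: commutator_def[of A "_ $ _ $ _"])
  then show ?thesis by (simp add: evals_sum evals_mult evals_pdiff[OF assms] evals_series)
qed

lemma T_hat_x_hat: "commutator (T_hat C i j) (x_hat C l) = (\<Sum>a\<in>UNIV. weyl_scale (C i l a) (T_hat C a j))"
  by (rule evals_unique[OF commutator_x_hat[OF evals_T]], unfold T_relation)
    (intro evals_X_mult evals_sum evals_c evals_T)

lemma Tinv_hat_x_hat: "commutator (Tinv_hat C i j) (x_hat C l) = (\<Sum>a\<in>UNIV. weyl_scale (C l a j) (Tinv_hat C i a))"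
  by (rule evals_unique[OF commutator_x_hat[OF evals_Tinv]], unfold Tinv_relation)
    (intro evals_X_mult evals_sum evals_c evals_Tinv)

text \<open>The factors \<open>weyl_x a\<close> have no symbol in the sense of \<open>evals\<close>.
  They are therefore kept on the left, and symbols are compared only for the coefficient of each
  \<open>weyl_x a\<close>.\<close>

lemma x_hat_x_hat: "commutator (x_hat C i) (x_hat C j) = (\<Sum>d\<in>UNIV. weyl_scale (C i j d) (x_hat C d))"
proof -
  define S where "S i a = matrix_fps psi (structure_matrix C) $ i $ a" for i a
  have S: "evals (Psi $ i $ a) (S i a)" for i a
    unfolding S_def by (rule evals_series)
  have x: "x_hat C i = (\<Sum>a\<in>UNIV. weyl_x a * S i a)" for i
    by (simp add: x_hat_def S_def)
  have 1: "commutator (S i a) (x_hat C j) = (\<Sum>b\<in>UNIV. commutator (S i a) (weyl_x b) * S j b)" for i j a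
    unfolding x commutator_sum_right commutator_mult_right
    using evals_commute[OF S S] by (simp add: commutator_def[of "S _ _" "S _ _"])
  have 2: "commutator (weyl_x a) (x_hat C j) = - (\<Sum>b\<in>UNIV. weyl_x b * commutator (S j b) (weyl_x a))" for a j
    unfolding x commutator_sum_right commutator_mult_right weyl_commutation_relations(1)
    by (simp add: commutator_swap[of "weyl_x a"] sum_negf)
  have 3: "(\<Sum>b\<in>UNIV. commutator (S i a) (weyl_x b) * S j b - commutator (S j a) (weyl_x b) * S i b) =
      (\<Sum>d\<in>UNIV. weyl_scale (C i j d) (S d a))" for a
  proof (rule evals_unique)
    show "evals (\<Sum>b\<in>UNIV. pd b (Psi $ i $ a) * Psi $ j $ b - pd b (Psi $ j $ a) * Psi $ i $ b)
        (\<Sum>b\<in>UNIV. commutator (S i a) (weyl_x b) * S j b - commutator (S j a) (weyl_x b) * S i b)"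
      by (intro evals_sum evals_diff evals_mult evals_pdiff S)
    show "evals (\<Sum>b\<in>UNIV. pd b (Psi $ i $ a) * Psi $ j $ b - pd b (Psi $ j $ a) * Psi $ i $ b)
        (\<Sum>d\<in>UNIV. weyl_scale (C i j d) (S d a))"
      unfolding Psi_relation by (intro evals_X_mult evals_sum evals_c S)
  qed
  have "commutator (x_hat C i) (x_hat C j) =
      (\<Sum>a\<in>UNIV. weyl_x a * commutator (S i a) (x_hat C j) + commutator (weyl_x a) (x_hat C j) * S i a)"
    unfolding x[of i] commutator_sum_left commutator_mult_left ..
  also have "\<dots> = (\<Sum>a\<in>UNIV. \<Sum>b\<in>UNIV. weyl_x a * (commutator (S i a) (weyl_x b) * S j b)) -
      (\<Sum>a\<in>UNIV. \<Sum>b\<in>UNIV. weyl_x b * (commutator (S j b) (weyl_x a) * S i a))"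
    unfolding 1 2 by (simp add: sum_subtractf sum_distrib_left sum_distrib_right mult.assoc)
  \<comment> \<open>Exchanging the roles of \<open>a\<close> and \<open>b\<close> lets
    \<open>weyl_x a\<close> be factored out of both sums.\<close>
  also have "(\<Sum>a\<in>UNIV. \<Sum>b\<in>UNIV. weyl_x b * (commutator (S j b) (weyl_x a) * S i a)) =
      (\<Sum>a\<in>UNIV. \<Sum>b\<in>UNIV. weyl_x a * (commutator (S j a) (weyl_x b) * S i b))"
    by (rule sum.swap)
  also have "(\<Sum>a\<in>UNIV. \<Sum>b\<in>UNIV. weyl_x a * (commutator (S i a) (weyl_x b) * S j b)) - \<dots> =
      (\<Sum>a\<in>UNIV. weyl_x a * (\<Sum>b\<in>UNIV. commutator (S i a) (weyl_x b) * S j b - commutator (S j a) (weyl_x b) * S i b))"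
    by (simp add: sum_subtractf sum_distrib_left right_diff_distrib)
  also have "\<dots> = (\<Sum>d\<in>UNIV. weyl_scale (C i j d) (x_hat C d))"
    unfolding 3 x weyl_scale_sum sum_distrib_left weyl_scale_times_right by (rule sum.swap)
  finally show ?thesis .
qed

lemma T_hat_Tinv_hat: "(\<Sum>a\<in>UNIV. T_hat C i a * Tinv_hat C a j) = (if i = j then 1 else 0)"
  and Tinv_hat_T_hat: "(\<Sum>a\<in>UNIV. Tinv_hat C i a * T_hat C a j) = (if i = j then 1 else 0)"
proof -
  have "evals (mat 1 $ i $ j :: ('n, 'k) mpolynomial fps) 1" if "i = j"
    using that evals_const[of "1 :: ('n, 'k) mpolynomial"] unfolding weyl_of_one fps_const_1_eq_1 by (simp add: mat_def)
  moreover have "evals (mat 1 $ i $ j :: ('n, 'k) mpolynomial fps) 0" if "i \<noteq> j"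
    using that evals_zero by (simp add: mat_def)
  ultimately have one: "evals (mat 1 $ i $ j :: ('n, 'k) mpolynomial fps) (if i = j then 1 else 0)"
    by presburger
  have "evals ((T ** Tinv) $ i $ j) (\<Sum>a\<in>UNIV. T_hat C i a * Tinv_hat C a j)"
    unfolding matrix_matrix_mult_def vec_lambda_beta by (intro evals_sum evals_mult evals_T evals_Tinv)
  then show "(\<Sum>a\<in>UNIV. T_hat C i a * Tinv_hat C a j) = (if i = j then 1 else 0)"
    unfolding T_mult_Tinv using one by (rule evals_unique)
  have "evals ((Tinv ** T) $ i $ j) (\<Sum>a\<in>UNIV. Tinv_hat C i a * T_hat C a j)"
    unfolding matrix_matrix_mult_def vec_lambda_beta by (intro evals_sum evals_mult evals_T evals_Tinv)
  then show "(\<Sum>a\<in>UNIV. Tinv_hat C i a * T_hat C a j) = (if i = j then 1 else 0)"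
    unfolding T_mult_Tinv using one by (rule evals_unique)
qed

end

section \<open>Homomorphisms out of the quotient\<close>

definition free_eval :: "('n generator \<Rightarrow> ('n::finite, 'k::field_char_0) weyl) \<Rightarrow> ('n, 'k) free_alg \<Rightarrow> ('n, 'k) weyl" where
  "free_eval v p = (\<Sum>w\<in>Poly_Mapping.keys p. weyl_scale (Poly_Mapping.lookup p w) (prod_list (map v (letters w))))"

lemma weyl_scale_add_left: "weyl_scale (r + s) A = weyl_scale r A + weyl_scale s A"
  for A :: "('n::finite, 'k::field_char_0) weyl"
  by (simp add: weyl_scale_eq single_add weyl_of_add distrib_right)

lemma weyl_scale_zero_left: "weyl_scale 0 A = 0"
  for A :: "('n::finite, 'k::field_char_0) weyl"
  by (simp add: weyl_scale_eq weyl_of_zero)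

lemma free_eval_superset:
  assumes "finite S" "Poly_Mapping.keys p \<subseteq> S"
  shows "free_eval v p = (\<Sum>w\<in>S. weyl_scale (Poly_Mapping.lookup p w) (prod_list (map v (letters w))))"
  unfolding free_eval_def
  by (rule sum.mono_neutral_left) (use assms in \<open>auto simp: weyl_scale_zero_left in_keys_iff\<close>)

lemma free_eval_add: "free_eval v (p + q) = free_eval v p + free_eval v q"
proof -
  let ?S = "Poly_Mapping.keys p \<union> Poly_Mapping.keys q"
  have "Poly_Mapping.keys (p + q) \<subseteq> ?S" by (rule keys_add)
  then show ?thesis
    by (simp add: free_eval_superset[of ?S] lookup_add weyl_scale_add_left sum.distrib)
qed

lemma free_eval_zero: "free_eval v 0 = 0"
  by (simp add: free_eval_def)

lemma free_eval_uminus: "free_eval v (- p) = - free_eval v p"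
  using free_eval_add[of v p "- p"] by (simp add: free_eval_zero eq_neg_iff_add_eq_0 add.commute)

lemma free_eval_diff: "free_eval v (p - q) = free_eval v p - free_eval v q"
  using free_eval_add[of v p "- q"] by (simp add: free_eval_uminus)

lemma free_eval_sum: "free_eval v (sum g S) = (\<Sum>s\<in>S. free_eval v (g s))"
  by (induction S rule: infinite_finite_induct) (simp_all add: free_eval_zero free_eval_add)

lemma free_eval_single: "free_eval v (Poly_Mapping.single w x) = weyl_scale x (prod_list (map v (letters w)))"
  by (subst free_eval_superset[of "{w}"]) auto

lemma free_alg_sum_single:
  "p = (\<Sum>w\<in>Poly_Mapping.keys p. Poly_Mapping.single w (Poly_Mapping.lookup p w))"
  by (intro poly_mapping_eqI) (auto simp: lookup_sum lookup_single when_def in_keys_iff)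

lemma free_eval_mult: "free_eval v (p * q) = free_eval v p * free_eval v q"
proof -
  let ?P = "\<lambda>p w. Poly_Mapping.single w (Poly_Mapping.lookup p w)"
  have single: "free_eval v (Poly_Mapping.single w x * Poly_Mapping.single u y) =
      free_eval v (Poly_Mapping.single w x) * free_eval v (Poly_Mapping.single u y)" for w x u y
    by (simp add: mult_single free_eval_single plus_word_def weyl_scale_times_left
        weyl_scale_times_right weyl_scale_weyl_scale mult.commute[of x y])
  have "free_eval v ((\<Sum>w\<in>Poly_Mapping.keys p. ?P p w) * (\<Sum>w\<in>Poly_Mapping.keys q. ?P q w)) =
      free_eval v (\<Sum>w\<in>Poly_Mapping.keys p. ?P p w) * free_eval v (\<Sum>w\<in>Poly_Mapping.keys q. ?P q w)"
    unfolding sum_product free_eval_sum single ..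
  then show ?thesis by (simp flip: free_alg_sum_single)
qed

lemma free_eval_one: "free_eval v 1 = 1"
proof -
  have "free_eval v (Poly_Mapping.single 0 1) = 1"
    unfolding free_eval_single by (simp add: zero_word_def weyl_scale_one)
  then show ?thesis by simp
qed

lemma free_eval_gen: "free_eval v (free_gen g) = v g"
  by (simp add: free_gen_def free_eval_single weyl_scale_one)

lemma free_eval_scale: "free_eval v (free_scale c p) = weyl_scale c (free_eval v p)"
  by (simp add: free_scale_eq free_eval_mult free_eval_single zero_word_def weyl_scale_times_left)

lemma free_eval_commutator: "free_eval v (commutator p q) = commutator (free_eval v p) (free_eval v q)"
  by (simp add: commutator_def free_eval_diff free_eval_mult)

lemma free_algebra_simps:
  "carrier (free_algebra :: ('k::field, ('n, 'k) free_alg) module) = UNIV"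
  "mult (free_algebra :: ('k, ('n, 'k) free_alg) module) = (*)"
  "add (free_algebra :: ('k, ('n, 'k) free_alg) module) = (+)"
  "one (free_algebra :: ('k, ('n, 'k) free_alg) module) = 1"
  "zero (free_algebra :: ('k, ('n, 'k) free_alg) module) = 0"
  by (simp_all add: free_algebra_def type_algebra_def)

text \<open>Since \<open>H_ideal\<close> is the least ideal containing the relators, this reduces
  vanishing on it to vanishing on the relators.\<close>

lemma ideal_free_eval_kernel: "ideal {p. free_eval v p = 0} free_algebra"
proof (rule idealI)
  show R: "ring (free_algebra :: ('b, ('a, 'b) free_alg) module)"
    unfolding free_algebra_def by (rule ring_type_algebra)
  interpret ring "free_algebra :: ('b, ('a, 'b) free_alg) module" by (rule R)
  have inv: "inv\<^bsub>add_monoid free_algebra\<^esub> p = - p" for p :: "('a, 'b) free_alg"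
    using minus_equality[of "- p" p] by (simp add: a_inv_def free_algebra_simps)
  show "subgroup {p. free_eval v p = 0} (add_monoid (free_algebra :: ('b, ('a, 'b) free_alg) module))"
  proof (rule subgroup.intro)
    fix p assume "p \<in> {p. free_eval v p = 0}"
    then show "inv\<^bsub>add_monoid free_algebra\<^esub> p \<in> {p. free_eval v p = 0}"
      unfolding inv by (simp add: free_eval_uminus)
  qed (auto simp: free_algebra_simps free_eval_add free_eval_zero)
qed (auto simp: free_algebra_simps free_eval_mult)

lemma H_ideal_free_eval:
  assumes "\<And>r. r \<in> H_relators C \<Longrightarrow> free_eval v r = 0" and "p \<in> H_ideal C"
  shows "free_eval v p = 0"
proof -
  interpret ring "free_algebra :: ('b, ('a, 'b) free_alg) module"
    unfolding free_algebra_def by (rule ring_type_algebra)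
  have "H_ideal C \<subseteq> {p. free_eval v p = 0}"
    unfolding H_ideal_def by (rule genideal_minimal[OF ideal_free_eval_kernel]) (use assms(1) in auto)
  then show ?thesis using assms(2) by auto
qed

lemma H_algebra_hom_exists:
  assumes "\<And>r. r \<in> H_relators C \<Longrightarrow> free_eval v r = 0"
  shows "\<exists>\<Phi>\<in>algebra_hom (H_algebra C) weyl_algebra. \<forall>g. \<Phi> (H_gen C g) = v g"
proof -
  interpret I: ideal "H_ideal C" "free_algebra :: ('b, ('a, 'b) free_alg) module" by (rule H_ideal_ideal)
  note [simp] = free_algebra_simps
  \<comment> \<open>Evaluates an arbitrary representative; the choice is immaterial, since two
    representatives differ by an element of the ideal, where \<open>free_eval v\<close>
    vanishes.\<close>
  define \<Phi> where "\<Phi> A = free_eval v (SOME p. p \<in> A)" for A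
  have \<Phi>: "\<Phi> (H_ideal C +>\<^bsub>free_algebra\<^esub> p) = free_eval v p" for p
  proof -
    have "p \<in> H_ideal C +>\<^bsub>free_algebra\<^esub> p" by (rule I.a_rcos_self) simp
    then have "(SOME q. q \<in> H_ideal C +>\<^bsub>free_algebra\<^esub> p) \<in> H_ideal C +>\<^bsub>free_algebra\<^esub> p"
      by (rule someI)
    then obtain i where "i \<in> H_ideal C" "(SOME q. q \<in> H_ideal C +>\<^bsub>free_algebra\<^esub> p) = i + p"
      by (auto simp: a_r_coset_def r_coset_def)
    then show ?thesis
      by (simp add: \<Phi>_def free_eval_add H_ideal_free_eval[OF assms])
  qed
  have carrier: "A \<in> carrier (H_algebra C) \<longleftrightarrow> (\<exists>p. A = H_ideal C +>\<^bsub>free_algebra\<^esub> p)" for A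
    by (auto simp: H_algebra_def quotient_algebra_def ring.defs FactRing_def A_RCOSETS_def' )
  have add: "add (H_algebra C) (H_ideal C +>\<^bsub>free_algebra\<^esub> p) (H_ideal C +>\<^bsub>free_algebra\<^esub> q) =
      H_ideal C +>\<^bsub>free_algebra\<^esub> (p + q)" for p q
    using I.a_rcos_sum[of p q] by (simp add: H_algebra_def quotient_algebra_def ring.defs FactRing_def)
  have mult: "mult (H_algebra C) (H_ideal C +>\<^bsub>free_algebra\<^esub> p) (H_ideal C +>\<^bsub>free_algebra\<^esub> q) =
      H_ideal C +>\<^bsub>free_algebra\<^esub> (p * q)" for p q
    using I.rcoset_mult_add[of p q] by (simp add: H_algebra_def quotient_algebra_def ring.defs FactRing_def)
  have one: "one (H_algebra C) = H_ideal C +>\<^bsub>free_algebra\<^esub> 1"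
    by (simp add: H_algebra_def quotient_algebra_def ring.defs FactRing_def)
  have "\<Phi> \<in> ring_hom (H_algebra C) weyl_algebra"
    by (rule ring_hom_memI)
      (auto simp: carrier add mult one \<Phi> free_eval_add free_eval_mult free_eval_one
        weyl_algebra_def type_algebra_def)
  moreover have "\<Phi> (c \<odot>\<^bsub>H_algebra C\<^esub> A) = c \<odot>\<^bsub>weyl_algebra\<^esub> \<Phi> A" if "A \<in> carrier (H_algebra C)" for c A
    using that by (auto simp: carrier smult_H_algebra \<Phi> free_eval_scale weyl_algebra_def type_algebra_def)
  ultimately have "\<Phi> \<in> algebra_hom (H_algebra C) weyl_algebra"
    by (simp add: algebra_hom_def)
  moreover have "\<Phi> (H_gen C g) = v g" for g
    by (simp add: H_gen_def \<Phi> free_eval_gen)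
  ultimately show ?thesis by blast
qed

lemma (in lie_symbol_calculus) H_algebra_realization:
  "\<exists>\<Phi>\<in>algebra_hom (H_algebra C) weyl_algebra.
    (\<forall>i. \<Phi> (H_gen C (GenX i)) = x_hat C i) \<and>
    (\<forall>i j. \<Phi> (H_gen C (GenT i j)) = T_hat C i j) \<and>
    (\<forall>i j. \<Phi> (H_gen C (GenTinv i j)) = Tinv_hat C i j)"
proof -
  define v where "v g = (case g of GenX i \<Rightarrow> x_hat C i | GenT i j \<Rightarrow> T_hat C i j | GenTinv i j \<Rightarrow> Tinv_hat C i j)" for g
  have v: "v (GenX i) = x_hat C i" "v (GenT i j) = T_hat C i j" "v (GenTinv i j) = Tinv_hat C i j" for i j
    by (simp_all add: v_def)
  have "commutator (T_hat C i j) (T_hat C k l) = 0" "commutator (Tinv_hat C i j) (Tinv_hat C k l) = 0" for i j k l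
    using evals_commute[OF evals_T evals_T] evals_commute[OF evals_Tinv evals_Tinv]
    by (simp_all add: commutator_def)
  then have "free_eval v r = 0" if "r \<in> H_relators C" for r
    using that unfolding H_relators_def Let_def
    by (auto simp: free_eval_diff free_eval_commutator free_eval_sum free_eval_scale free_eval_mult
        free_eval_gen v x_hat_x_hat T_hat_x_hat Tinv_hat_x_hat T_hat_Tinv_hat Tinv_hat_T_hat
        free_eval_one free_eval_zero)
  from H_algebra_hom_exists[OF this] show ?thesis by (metis v)
qed

section \<open>Structure constants of a Lie algebra\<close>

text \<open>Linear independence allows the antisymmetry and Jacobi identities of basis vectors to be
  compared coefficient by coefficient.\<close>

lemma lie_algebra_structure_constants:
  fixes C :: "'n::finite \<Rightarrow> 'n \<Rightarrow> 'n \<Rightarrow> 'k::field_char_0" and X :: "'n \<Rightarrow> 'g::ab_group_add"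
    and scale :: "'k \<Rightarrow> 'g \<Rightarrow> 'g" and bracket :: "'g \<Rightarrow> 'g \<Rightarrow> 'g"
  assumes "lie_algebra scale bracket" and basis: "vector_space.indexed_basis scale X"
    and bracket: "\<And>i j. bracket (X i) (X j) = (\<Sum>a\<in>UNIV. scale (C i j a) (X a))"
  shows "lie_symbol_calculus C"
proof -
  interpret lie_algebra scale bracket by fact
  have inj: "inj X" and indep: "independent (range X)"
    using basis by (simp_all add: indexed_basis_def)
  have zero: "f a = 0" if "(\<Sum>a\<in>UNIV. scale (f a) (X a)) = 0" for f a
  proof -
    \<comment> \<open>Independence concerns the set \<open>range X\<close>; injectivity of
      \<open>X\<close> transfers it to sums over the index type.\<close>
    have "(\<Sum>x\<in>range X. scale (f (the_inv X x)) x) = 0"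
      using that by (simp add: sum.reindex[OF inj] the_inv_f_f[OF inj])
    then have "f (the_inv X (X a)) = 0"
      using independentD[OF indep, of "range X" "\<lambda>x. f (the_inv X x)" "X a"] by simp
    then show ?thesis by (simp add: the_inv_f_f[OF inj])
  qed
  have bracket_sum_right: "bracket x (sum g S) = (\<Sum>s\<in>S. bracket x (g s))" for x and g :: "'n \<Rightarrow> 'g" and S
  proof -
    have "bracket x 0 = 0" using bracket_add_right[of x 0 0] by simp
    then show ?thesis
      by (induction S rule: infinite_finite_induct) (simp_all add: bracket_add_right)
  qed
  have bracket_antisym: "bracket x y = - bracket y x" for x y
  proof -
    have "bracket x x + bracket y x + (bracket x y + bracket y y) = 0"
      using bracket_self[of "x + y"] by (simp only: bracket_add_left bracket_add_right)
    then show ?thesis by (simp add: bracket_self eq_neg_iff_add_eq_0 add.commute)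
  qed
  have antisym: "C i j l = - C j i l" for i j l
  proof -
    have "(\<Sum>a\<in>UNIV. scale (C i j a + C j i a) (X a)) = bracket (X i) (X j) + bracket (X j) (X i)"
      by (simp add: bracket scale_left_distrib sum.distrib)
    also have "\<dots> = 0" using bracket_antisym[of "X i" "X j"] by simp
    finally show ?thesis using zero by (simp add: eq_neg_iff_add_eq_0)
  qed
  \<comment> \<open>Expansion gives \<open>C l k m\<close>; antisymmetry changes it into the
    contraction used in \<open>structure_constants\<close>, at the cost of the sign.\<close>
  have triple: "bracket (X l) (bracket (X i) (X j)) = - (\<Sum>m\<in>UNIV. scale (\<Sum>k\<in>UNIV. C i j k * C k l m) (X m))" for i j l
  proof -
    have "bracket (X l) (bracket (X i) (X j)) = (\<Sum>k\<in>UNIV. \<Sum>m\<in>UNIV. scale (C i j k * C l k m) (X m))"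
      by (simp add: bracket[of i j] bracket_sum_right bracket_scale_right bracket[of l] scale_sum_right)
    also have "\<dots> = (\<Sum>m\<in>UNIV. \<Sum>k\<in>UNIV. scale (- (C i j k * C k l m)) (X m))"
      by (subst sum.swap, subst antisym) simp
    finally show ?thesis by (simp add: scale_sum_left sum_negf scale_minus_left)
  qed
  have "(\<Sum>k\<in>UNIV. C i j k * C k l m) + (\<Sum>k\<in>UNIV. C j l k * C k i m) + (\<Sum>k\<in>UNIV. C l i k * C k j m) = 0" for i j l m
  proof -
    have "(\<Sum>m\<in>UNIV. scale ((\<Sum>k\<in>UNIV. C i j k * C k l m) + (\<Sum>k\<in>UNIV. C j l k * C k i m) +
        (\<Sum>k\<in>UNIV. C l i k * C k j m)) (X m)) =
        - (bracket (X l) (bracket (X i) (X j)) + bracket (X i) (bracket (X j) (X l)) + bracket (X j) (bracket (X l) (X i)))"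
      unfolding triple by (simp add: scale_left_distrib sum.distrib)
    also have "\<dots> = 0" by (simp add: jacobi)
    finally show ?thesis by (rule zero)
  qed
  then show ?thesis using antisym by unfold_locales
qed

theorem theorem3:
  fixes C :: "real \<Rightarrow> 'n::finite \<Rightarrow> 'n \<Rightarrow> 'n \<Rightarrow> 'k::real_normed_field"
    and scale :: "real \<Rightarrow> 'k \<Rightarrow> 'g::ab_group_add \<Rightarrow> 'g"
    and bracket :: "real \<Rightarrow> 'g \<Rightarrow> 'g \<Rightarrow> 'g"
    and X :: "real \<Rightarrow> 'n \<Rightarrow> 'g"
  assumes "\<And>h. lie_algebra (scale h) (bracket h)"
    and "\<And>h. vector_space.indexed_basis (scale h) (X h)"
    and "\<And>h \<mu> \<nu>. bracket h (X h \<mu>) (X h \<nu>) = (\<Sum>\<alpha>\<in>UNIV. scale h (C h \<mu> \<nu> \<alpha>) (X h \<alpha>))"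
    and "\<And>\<mu> \<nu> \<alpha>. ((\<lambda>h. C h \<mu> \<nu> \<alpha>) \<longlongrightarrow> 0) (at 0)"
  shows "\<forall>h. \<exists>\<Phi> \<in> algebra_hom (H_algebra (C h)) weyl_algebra.
    (\<forall>\<mu>. \<Phi> (H_gen (C h) (GenX \<mu>)) = x_hat (C h) \<mu>) \<and>
    (\<forall>\<mu> \<nu>. \<Phi> (H_gen (C h) (GenT \<mu> \<nu>)) = T_hat (C h) \<mu> \<nu>) \<and>
    (\<forall>\<mu> \<nu>. \<Phi> (H_gen (C h) (GenTinv \<mu> \<nu>)) = Tinv_hat (C h) \<mu> \<nu>)"
  using lie_symbol_calculus.H_algebra_realization[OF lie_algebra_structure_constants[OF assms(1,2,3)]] by blast

end
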